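(* Let $N\ge 1$ be an integer, let $n_0=d,\,n_1,\dots,n_{N-1},\,n_N=k$ be positive integers, let $\eta>0$ and $\lambda\ge 0$, and let $L^1:\mathbb{R}^{k\times d}\to\mathbb{R}_{\ge 0}$ be the (differentiable) training loss of the linear model and $L^N(W_1,\dots,W_N)=L^1(W_NW_{N-1}\cdots W_1)$ the training loss of the depth-$N$ linear network. Assume that the time-dependent weight matrices $W_j(t)\in\mathbb{R}^{n_j\times n_{j-1}}$, $j=1,\dots,N$, follow the dynamics of continuous gradient descent $$\dot W_j(t)=-\eta\lambda W_j(t)-\eta\,\frac{\partial L^N}{\partial W_j}\big(W_1(t),\dots,W_N(t)\big),\qquad j=1,\dots,N,$$ for $t\ge t_0$ (on the time interval on which the trajectory is considered, with initial time $t_0$). Assume also that the initial values satisfy $$W_{j+1}^\top(t_0)W_{j+1}(t_0)=W_j(t_0)W_j^\top(t_0),\qquad j=1,\dots,N-1.$$ Then the end-to-end weight matrix $W_e(t):=W_N(t)W_{N-1}(t)\cdots W_1(t)\in\mathbb{R}^{k\times d}$ is governed by the differential equation $$\dot W_e(t)=-\eta\lambda N\cdot W_e(t)-\eta\sum_{j=1}^N\big[W_e(t)W_e^\top(t)\big]^{\frac{j-1}{N}}\cdot\frac{dL^1}{dW}(W_e(t))\cdot\big[W_e^\top(t)W_e(t)\big]^{\frac{N-j}{N}},$$ where $[\cdot]^{\frac{j-1}{N}}$ and $[\cdot]^{\frac{N-j}{N}}$ are fractional power operators on positive semidefinite matrices.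
   Context: Training loss: given training data $(\mathbf{x}^{(i)},\mathbf{y}^{(i)})\in\mathbb{R}^d\times\mathbb{R}^k$, $i=1,\dots,m$, and a point-wise loss $l:\mathbb{R}^k\times\mathbb{R}^k\to\mathbb{R}_{\ge0}$ (arbitrary, such that the gradients below exist), $L^1(W):=\frac1m\sum_{i=1}^m l(W\mathbf{x}^{(i)},\mathbf{y}^{(i)})$ for $W\in\mathbb{R}^{k\times d}$. Gradients with respect to matrices: $\frac{dL^1}{dW}(W)$ is the $k\times d$ matrix of partial derivatives of $L^1$ with respect to the entries of $W$; $\frac{\partial L^N}{\partial W_j}$ is likewise the $n_j\times n_{j-1}$ matrix of partial derivatives of $L^N$ with respect to the entries of $W_j$. A dot denotes the derivative with respect to the continuous time $t$. Fractional powers: for a real symmetric positive semidefinite matrix $A=Q\,\mathrm{diag}(a_1,\dots,a_n)Q^\top$ ($Q$ orthogonal, $a_i\ge0$) and $s\ge0$, $[A]^s:=Q\,\mathrm{diag}(a_1^s,\dots,a_n^s)Q^\top$, with the convention that $[A]^0$ is the identity matrix (i.e. $0^0=1$). *)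

theory Defs
  imports "HOL-Analysis.Analysis" "Jordan_Normal_Form.Matrix"
begin

hide_const (open) Finite_Cartesian_Product.vec Finite_Cartesian_Product.mat
no_notation Finite_Cartesian_Product.vec_nth (infixl \<open>$\<close> 90)

text \<open>Unlike \<^const>\<open>powr\<close>, this satisfies \<open>0\<^sup>0 = 1\<close>.\<close>

definition npowr :: "real \<Rightarrow> real \<Rightarrow> real" where
  "npowr x s = (if s = 0 then 1 else x powr s)"

definition is_psd_power :: "real mat \<Rightarrow> real \<Rightarrow> real mat \<Rightarrow> bool" where
  "is_psd_power A s B \<longleftrightarrow>
     (\<exists>n Q a. Q \<in> carrier_mat n n \<and> Q * Q\<^sup>T = 1\<^sub>m n \<and> Q\<^sup>T * Q = 1\<^sub>m n \<and>
        (\<forall>i<n. a i \<ge> 0) \<and>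
        A = Q * mat_diag n a * Q\<^sup>T \<and>
        B = Q * mat_diag n (\<lambda>i. npowr (a i) s) * Q\<^sup>T)"

lemma is_psd_power_unique:
  assumes "is_psd_power A s B" "is_psd_power A s B'"
  shows "B = B'"
proof -
  obtain n Q a where Q: "Q \<in> carrier_mat n n" "Q * Q\<^sup>T = 1\<^sub>m n" "Q\<^sup>T * Q = 1\<^sub>m n"
    and A: "A = Q * mat_diag n a * Q\<^sup>T"
    and B: "B = Q * mat_diag n (\<lambda>i. npowr (a i) s) * Q\<^sup>T"
    using assms(1) unfolding is_psd_power_def by blast
  obtain n' R b where R': "R \<in> carrier_mat n' n'" "R * R\<^sup>T = 1\<^sub>m n'" "R\<^sup>T * R = 1\<^sub>m n'"
    and A': "A = R * mat_diag n' b * R\<^sup>T"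
    and B'0: "B' = R * mat_diag n' (\<lambda>i. npowr (b i) s) * R\<^sup>T"
    using assms(2) unfolding is_psd_power_def by blast
  have "dim_row A = n" using A Q(1) by simp
  moreover have "dim_row A = n'" using A' R'(1) by simp
  ultimately have n: "n' = n" by simp
  note R = R'[unfolded n] and A' = A'[unfolded n] and B' = B'0[unfolded n]
  have Qt[simp]: "Q\<^sup>T \<in> carrier_mat n n" and Rt[simp]: "R\<^sup>T \<in> carrier_mat n n"
    and D[simp]: "mat_diag n f \<in> carrier_mat n n" for f :: "nat \<Rightarrow> real"
    using Q R by auto
  note [simp] = Q(1) R(1) mult_carrier_mat[of _ n n _ n]
  have conj: "R\<^sup>T * (Q * X * Q\<^sup>T) * Q = (R\<^sup>T * Q) * X" if [simp]: "X \<in> carrier_mat n n" for X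
  proof -
    have "R\<^sup>T * (Q * X * Q\<^sup>T) * Q = R\<^sup>T * Q * X * (Q\<^sup>T * Q)"
      by (simp add: assoc_mult_mat[of _ n n _ n _ n])
    then show ?thesis using Q(3) by (simp add: right_mult_one_mat[of _ n n])
  qed
  have conj': "R\<^sup>T * (R * X * R\<^sup>T) * Q = X * (R\<^sup>T * Q)" if [simp]: "X \<in> carrier_mat n n" for X
  proof -
    have "R\<^sup>T * (R * X * R\<^sup>T) * Q = (R\<^sup>T * R) * (X * (R\<^sup>T * Q))"
      by (simp add: assoc_mult_mat[of _ n n _ n _ n])
    then show ?thesis using R(3) by (simp add: left_mult_one_mat[of _ n n])
  qed
  define P where "P = R\<^sup>T * Q"
  have P[simp]: "P \<in> carrier_mat n n" unfolding P_def by simp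
  have [simp]: "dim_row P = n" "dim_col P = n" using carrier_matD[OF P] by simp_all
  have eq: "P * mat_diag n a = mat_diag n b * P"
    using conj[OF D, of a] conj'[OF D, of b] A A' P_def by simp
  have "P * mat_diag n (\<lambda>i. npowr (a i) s) = mat_diag n (\<lambda>i. npowr (b i) s) * P"
  proof (rule eq_matI)
    fix i j assume ij: "i < dim_row (mat_diag n (\<lambda>i. npowr (b i) s) * P)"
      "j < dim_col (mat_diag n (\<lambda>i. npowr (b i) s) * P)"
    then have ij: "i < n" "j < n" using P by (auto simp: mat_diag_def)
    have "(P * mat_diag n a) $$ (i,j) = (mat_diag n b * P) $$ (i,j)" using eq by simp
    then have "P $$ (i,j) * a j = b i * P $$ (i,j)"
      using ij by (simp add: mat_diag_mult_right[of _ n n] mat_diag_mult_left[of _ n n])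
    then have "P $$ (i,j) = 0 \<or> a j = b i" by auto
    then show "(P * mat_diag n (\<lambda>i. npowr (a i) s)) $$ (i,j)
        = (mat_diag n (\<lambda>i. npowr (b i) s) * P) $$ (i,j)"
      using ij by (auto simp add: mat_diag_mult_right[of _ n n] mat_diag_mult_left[of _ n n])
  qed (use P in \<open>auto simp: mat_diag_def\<close>)
  then have *: "R\<^sup>T * B * Q = R\<^sup>T * B' * Q"
    unfolding B B' conj[OF D] conj'[OF D] P_def .
  have Bc: "B \<in> carrier_mat n n" "B' \<in> carrier_mat n n"
    unfolding B B' by simp_all
  have cancel: "R * (R\<^sup>T * X * Q) * Q\<^sup>T = X" if [simp]: "X \<in> carrier_mat n n" for X
  proof -
    have "R * (R\<^sup>T * X * Q) * Q\<^sup>T = (R * R\<^sup>T) * X * (Q * Q\<^sup>T)"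
      by (simp add: assoc_mult_mat[of _ n n _ n _ n])
    then show ?thesis using R(2) Q(2)
      by (simp add: left_mult_one_mat[of _ n n] right_mult_one_mat[of _ n n])
  qed
  have "B = R * (R\<^sup>T * B * Q) * Q\<^sup>T" by (simp only: cancel[OF Bc(1)])
  also have "\<dots> = B'" unfolding * by (rule cancel[OF Bc(2)])
  finally show ?thesis .
qed

definition psd_power :: "real mat \<Rightarrow> real \<Rightarrow> real mat" where
  "psd_power A s = (THE B. is_psd_power A s B)"

lemma psd_power_eqI: "is_psd_power A s B \<Longrightarrow> psd_power A s = B"
  unfolding psd_power_def using is_psd_power_unique by blast


definition has_mat_derivative_within ::
    "(real \<Rightarrow> real mat) \<Rightarrow> real mat \<Rightarrow> real \<Rightarrow> real set \<Rightarrow> bool" where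
  "has_mat_derivative_within F D t T \<longleftrightarrow>
     (\<forall>s\<in>T. F s \<in> carrier_mat (dim_row D) (dim_col D)) \<and>
     (\<forall>i<dim_row D. \<forall>j<dim_col D.
        ((\<lambda>s. F s $$ (i,j)) has_real_derivative D $$ (i,j)) (at t within T))"

definition mat_grad :: "(real mat \<Rightarrow> real) \<Rightarrow> real mat \<Rightarrow> real mat" where
  "mat_grad f A = mat (dim_row A) (dim_col A)
     (\<lambda>ij. deriv (\<lambda>x. f (update_mat A ij x)) (A $$ ij))"

definition frob_inner :: "real mat \<Rightarrow> real mat \<Rightarrow> real" where
  "frob_inner A B = (\<Sum>i<dim_row A. \<Sum>j<dim_col A. A $$ (i,j) * B $$ (i,j))"

definition frob_norm :: "real mat \<Rightarrow> real" where
  "frob_norm A = sqrt (frob_inner A A)"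

text \<open>Frechet differentiability at \<open>A\<close> of a function on the matrices of the same format as \<open>A\<close>
  (the type \<^typ>\<open>real mat\<close> contains matrices of all formats and is not a normed space).\<close>

definition mat_differentiable_at :: "(real mat \<Rightarrow> real) \<Rightarrow> real mat \<Rightarrow> bool" where
  "mat_differentiable_at f A \<longleftrightarrow>
     (\<exists>G \<in> carrier_mat (dim_row A) (dim_col A). \<forall>e>0. \<exists>\<delta>>0.
        \<forall>H \<in> carrier_mat (dim_row A) (dim_col A). frob_norm H < \<delta> \<longrightarrow>
          \<bar>f (A + H) - f A - frob_inner G H\<bar> \<le> e * frob_norm H)"


definition linear_loss ::
    "(real vec \<Rightarrow> real vec \<Rightarrow> real) \<Rightarrow> nat \<Rightarrow> (nat \<Rightarrow> real vec) \<Rightarrow> (nat \<Rightarrow> real vec) \<Rightarrow> real mat \<Rightarrow> real"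
  where "linear_loss l m x y W = (1 / real m) * (\<Sum>i = 1..m. l (W *\<^sub>v x i) (y i))"

text \<open>The product \<open>W N * \<dots> * W 1\<close>; the weights are indexed from 1.\<close>

fun end_to_end :: "(nat \<Rightarrow> real mat) \<Rightarrow> nat \<Rightarrow> real mat" where
  "end_to_end W 0 = 1\<^sub>m (dim_col (W 1))"
| "end_to_end W (Suc j) = W (Suc j) * end_to_end W j"

definition deep_loss :: "(real mat \<Rightarrow> real) \<Rightarrow> nat \<Rightarrow> (nat \<Rightarrow> real mat) \<Rightarrow> real" where
  "deep_loss L1 N W = L1 (end_to_end W N)"

definition deep_loss_grad ::
    "(real mat \<Rightarrow> real) \<Rightarrow> nat \<Rightarrow> nat \<Rightarrow> (nat \<Rightarrow> real mat) \<Rightarrow> real mat" where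
  "deep_loss_grad L1 N j W = mat_grad (\<lambda>M. deep_loss L1 N (W(j := M))) (W j)"

end

theory Submission
  imports Defs "Jordan_Normal_Form.Char_Poly"
begin

text \<open>Gradient descent with weight decay preserves balancedness: the chain rule gives
  \<open>W\<^bsub>j+1\<^esub>\<^sup>T \<partial>L/\<partial>W\<^bsub>j+1\<^esub> = (\<partial>L/\<partial>W\<^bsub>j\<^esub>) W\<^bsub>j\<^esub>\<^sup>T\<close>, so each difference
  \<open>W\<^bsub>j+1\<^esub>\<^sup>T W\<^bsub>j+1\<^esub> - W\<^bsub>j\<^esub> W\<^bsub>j\<^esub>\<^sup>T\<close> solves \<open>D' = -2 \<eta> \<lambda> D\<close> and vanishes initially.
  Balancedness telescopes the Gram matrices of partial products, in particular
  \<open>W\<^bsub>e\<^esub> W\<^bsub>e\<^esub>\<^sup>T = (W\<^bsub>N\<^esub> W\<^bsub>N\<^esub>\<^sup>T)\<^sup>N\<close> and \<open>W\<^bsub>e\<^esub>\<^sup>T W\<^bsub>e\<^esub> = (W\<^bsub>1\<^esub>\<^sup>T W\<^bsub>1\<^esub>)\<^sup>N\<close>. Hence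
  the factors that surround the gradient in each summand of the product rule for \<open>W\<^bsub>e\<^esub>\<close> are
  fractional powers of \<open>W\<^bsub>e\<^esub> W\<^bsub>e\<^esub>\<^sup>T\<close> and \<open>W\<^bsub>e\<^esub>\<^sup>T W\<^bsub>e\<^esub>\<close>; no singular value decomposition is
  needed, only the spectral theorem for the single matrices \<open>W\<^bsub>N\<^esub> W\<^bsub>N\<^esub>\<^sup>T\<close> and \<open>W\<^bsub>1\<^esub>\<^sup>T W\<^bsub>1\<^esub>\<close>.\<close>

section \<open>Entries, regrouping and sums of matrices\<close>

lemma index_mult_mat_sum:
  assumes "i < dim_row A" "j < dim_col B" "dim_col A = dim_row B"
  shows "(A * B) $$ (i,j) = (\<Sum>k<dim_row B. A $$ (i,k) * B $$ (k,j))"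
  using assms by (auto simp: scalar_prod_def atLeast0LessThan intro!: sum.cong)

text \<open>The premises are equations between dimensions, not carrier memberships with free
  dimensions, so the simplifier can discharge them while regrouping long products.\<close>

lemma mult_mat_assoc_dim:
  fixes A B C :: "'a :: semiring_0 mat"
  assumes "dim_col A = dim_row B" "dim_col B = dim_row C"
  shows "A * B * C = A * (B * C)"
  by (rule assoc_mult_mat[of _ "dim_row A" "dim_row B" _ "dim_row C" _ "dim_col C"])
     (use assms in auto)

lemma transpose_mult_dim:
  fixes A B :: "'a :: comm_semiring_0 mat"
  assumes "dim_col A = dim_row B"
  shows "(A * B)\<^sup>T = B\<^sup>T * A\<^sup>T"
  by (rule transpose_mult[of _ "dim_row A" "dim_row B" _ "dim_col B"]) (use assms in auto)

text \<open>Turns sums in the group of matrices of a fixed format, as used in the final statement,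
  into sums of entries.\<close>

lemma index_finsum_mat:
  fixes F :: "'b \<Rightarrow> 'a :: comm_ring_1 mat"
  assumes "finite S" "\<And>s. s \<in> S \<Longrightarrow> F s \<in> carrier_mat nr nc"
  shows "(\<Oplus>\<^bsub>module_mat TYPE('a) nr nc\<^esub> s\<in>S. F s) = mat nr nc (\<lambda>ij. \<Sum>s\<in>S. F s $$ ij)"
  using assms
proof (induction S rule: finite_induct)
  interpret abelian_group "module_mat TYPE('a) nr nc" by (rule abelian_group_mat)
  case empty
  show ?case by (auto simp: module_mat_simps)
next
  interpret abelian_group "module_mat TYPE('a) nr nc" by (rule abelian_group_mat)
  case (insert s S)
  then show ?case
    by (subst finsum_insert) (auto simp: module_mat_simps intro!: eq_matI)
qed

subsection \<open>Orthogonal diagonalization of real symmetric matrices\<close>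

text \<open>The fundamental theorem of algebra gives a complex eigenvalue. Symmetry makes it real,
  so the real and imaginary parts of an eigenvector satisfy the eigenvalue equation too, and one of
  them is nonzero.\<close>

lemma symmetric_real_eigenvector:
  fixes A :: "real mat"
  assumes A: "A \<in> carrier_mat n n" and sym: "A\<^sup>T = A" and n: "n > 0"
  obtains u c where "\<And>i. i < n \<Longrightarrow> (\<Sum>k<n. A $$ (i,k) * u k) = c * u i" "(\<Sum>i<n. (u i)\<^sup>2) = 1"
proof -
  \<comment> \<open>\<open>that\<close> is rebound inside the \<open>if\<close> blocks
    below.\<close>
  note result = that
  let ?C = "map_mat complex_of_real A"
  have C: "?C \<in> carrier_mat n n" using A by simp
  have "degree (char_poly ?C) = n" using degree_monic_char_poly[OF C] by simp
  then have "\<not> constant (poly (char_poly ?C))" using n by (simp add: constant_degree)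
  then obtain \<mu> where "poly (char_poly ?C) \<mu> = 0" using fundamental_theorem_of_algebra by blast
  then obtain v where v: "v \<in> carrier_vec n" "v \<noteq> 0\<^sub>v n" "?C *\<^sub>v v = \<mu> \<cdot>\<^sub>v v"
    using eigenvalue_root_char_poly[OF C] C unfolding eigenvalue_def eigenvector_def by auto
  have Av: "(\<Sum>k<n. A $$ (i,k) * v $ k) = \<mu> * v $ i" if "i < n" for i
  proof -
    have "(?C *\<^sub>v v) $ i = (\<Sum>k<n. A $$ (i,k) * v $ k)"
      using A v(1) that by (auto simp: scalar_prod_def atLeast0LessThan intro!: sum.cong)
    then show ?thesis using v that by simp
  qed
  have symi: "A $$ (i,k) = A $$ (k,i)" if "i < n" "k < n" for i k
    using index_transpose_mat(1)[of i A k] A sym that by simp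
  obtain i0 where i0: "i0 < n" "v $ i0 \<noteq> 0"
    using v(1,2) by (metis carrier_vecD eq_vecI index_zero_vec)
  define s where "s = (\<Sum>i<n. (cmod (v $ i))\<^sup>2)"
  have "s \<ge> (cmod (v $ i0))\<^sup>2"
    unfolding s_def by (rule member_le_sum) (use i0 in auto)
  then have s: "s > 0" using i0(2) by (smt (verit) zero_less_norm_iff zero_less_power)
  \<comment> \<open>\<open>S\<close> is the Hermitian form of \<open>A\<close> at \<open>v\<close>.
    The eigenvalue equation gives \<open>\<mu> * of_real s\<close>, symmetry of the real matrix
    gives \<open>cnj S = S\<close>, and \<open>s > 0\<close>; hence \<open>\<mu>\<close> is
    real.\<close>
  define S where "S = (\<Sum>i<n. \<Sum>k<n. cnj (v $ i) * (A $$ (i,k) * v $ k))"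
  have "S = (\<Sum>i<n. cnj (v $ i) * (\<mu> * v $ i))"
    unfolding S_def sum_distrib_left[symmetric] by (intro sum.cong refl) (simp add: Av)
  also have "\<dots> = \<mu> * of_real s"
    unfolding s_def of_real_sum sum_distrib_left
    by (intro sum.cong refl) (simp only: complex_norm_square mult_ac)
  finally have S1: "S = \<mu> * of_real s" .
  have "cnj S = (\<Sum>i<n. \<Sum>k<n. v $ i * (A $$ (i,k) * cnj (v $ k)))"
    unfolding S_def by simp
  also have "\<dots> = (\<Sum>k<n. \<Sum>i<n. v $ i * (A $$ (i,k) * cnj (v $ k)))"
    by (rule sum.swap)
  also have "\<dots> = S"
    unfolding S_def by (intro sum.cong refl) (simp add: symi mult_ac)
  finally have "cnj \<mu> = \<mu>" using s unfolding S1 by simp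
  then have \<mu>: "\<mu> = of_real (Re \<mu>)" by (simp add: complex_eq_iff)
  have main: "thesis" if w: "\<And>i. i < n \<Longrightarrow> (\<Sum>k<n. A $$ (i,k) * w k) = Re \<mu> * w i"
    and w0: "w i0 \<noteq> 0" for w :: "nat \<Rightarrow> real"
  proof -
    define r where "r = (\<Sum>i<n. (w i)\<^sup>2)"
    have "r \<ge> (w i0)\<^sup>2" unfolding r_def by (rule member_le_sum) (use i0 in auto)
    then have r: "r > 0" using w0 by (smt (verit) zero_less_power2)
    show thesis
    proof (rule result[of "\<lambda>i. w i / sqrt r" "Re \<mu>"])
      show "(\<Sum>i<n. (w i / sqrt r)\<^sup>2) = 1"
        using r by (simp add: power_divide sum_divide_distrib[symmetric] r_def[symmetric])
    qed (simp add: w sum_divide_distrib[symmetric])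
  qed
  have Re: "(\<Sum>k<n. A $$ (i,k) * Re (v $ k)) = Re \<mu> * Re (v $ i)"
    and Im: "(\<Sum>k<n. A $$ (i,k) * Im (v $ k)) = Re \<mu> * Im (v $ i)" if "i < n" for i
  proof -
    have "(\<Sum>k<n. A $$ (i,k) * v $ k) = of_real (Re \<mu>) * v $ i" using Av[OF that] \<mu> by simp
    then show "(\<Sum>k<n. A $$ (i,k) * Re (v $ k)) = Re \<mu> * Re (v $ i)"
      and "(\<Sum>k<n. A $$ (i,k) * Im (v $ k)) = Re \<mu> * Im (v $ i)"
      by (simp_all add: complex_eq_iff)
  qed
  show thesis
  proof (cases "Re (v $ i0) = 0")
    case True
    then have "Im (v $ i0) \<noteq> 0" using i0(2) by (simp add: complex_eq_iff)
    then show thesis using main[of "\<lambda>k. Im (v $ k)"] Im by blast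
  next
    case False
    then show thesis using main[of "\<lambda>k. Re (v $ k)"] Re by blast
  qed
qed

text \<open>The witness is a Householder reflection; if the given vector is already the first basis
  vector, the coefficient \<open>2 / 0 = 0\<close> makes it the identity.\<close>

lemma symmetric_orthogonal_with_first_col:
  fixes u :: "nat \<Rightarrow> real"
  assumes u: "(\<Sum>i<n. (u i)\<^sup>2) = 1" and n: "n > 0"
  obtains H :: "real mat" where "H \<in> carrier_mat n n" "H\<^sup>T = H" "H * H = 1\<^sub>m n"
    "\<And>i. i < n \<Longrightarrow> H $$ (i,0) = u i"
proof -
  define w where "w i = u i - (if i = 0 then 1 else 0)" for i
  define s where "s = (\<Sum>i<n. (w i)\<^sup>2)"
  define c where "c = 2 / s"
  define H where "H = mat n n (\<lambda>(i,j). (if i = j then 1 else 0) - c * w i * w j)"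
  have H: "H \<in> carrier_mat n n" unfolding H_def by simp
  have s: "s = 2 * (1 - u 0)"
  proof -
    have "s = (\<Sum>i<n. (u i)\<^sup>2 + (if i = 0 then 1 - 2 * u 0 else 0))"
      unfolding s_def w_def by (intro sum.cong) (auto simp: power2_eq_square algebra_simps)
    also have "\<dots> = 2 * (1 - u 0)"
      using n u by (simp add: sum.distrib)
    finally show ?thesis .
  qed
  have w0: "w i = 0" if "s = 0" "i < n" for i
    using that unfolding s_def by (subst (asm) sum_nonneg_eq_0_iff) auto
  \<comment> \<open>Also true for \<open>s = 0\<close>, where \<open>c = 0\<close>; so the proof of
    \<open>HH\<close> needs no case distinction.\<close>
  have sc: "c\<^sup>2 * s = 2 * c" unfolding c_def by (simp add: power2_eq_square)
  have sym: "H\<^sup>T = H" by (rule eq_matI) (auto simp: H_def)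
  have HH: "H * H = 1\<^sub>m n"
  proof (rule eq_matI)
    fix i j assume "i < dim_row (1\<^sub>m n :: real mat)" "j < dim_col (1\<^sub>m n :: real mat)"
    then have ij: "i < n" "j < n" by auto
    have "(H * H) $$ (i,j) = (\<Sum>k<n. H $$ (i,k) * H $$ (k,j))"
      using H ij by (subst index_mult_mat_sum) auto
    also have "\<dots> = (\<Sum>k<n. (if k = i then (if i = j then 1 else 0) - c * w i * w j else 0)
        - (if k = j then c * w i * w j else 0) + c\<^sup>2 * w i * w j * (w k)\<^sup>2)"
      unfolding H_def using ij
      by (intro sum.cong) (auto simp: power2_eq_square algebra_simps)
    also have "\<dots> = (if i = j then 1 else 0) - 2 * c * w i * w j + c\<^sup>2 * w i * w j * s"
      unfolding s_def using ij by (simp add: sum.distrib sum_subtractf sum_distrib_left)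
    also have "\<dots> = (if i = j then 1 else 0) - 2 * c * w i * w j + c\<^sup>2 * s * (w i * w j)"
      by simp
    also have "\<dots> = (1\<^sub>m n :: real mat) $$ (i,j)"
      unfolding sc using ij by simp
    finally show "(H * H) $$ (i,j) = (1\<^sub>m n :: real mat) $$ (i,j)" .
  qed (use H in auto)
  have "H $$ (i,0) = u i" if i: "i < n" for i
  proof (cases "s = 0")
    case True
    then show ?thesis using w0[OF True i] i n unfolding H_def w_def c_def by auto
  next
    case False
    \<comment> \<open>Hence \<open>c * w 0 = -1\<close>, and the first column of \<open>H\<close> is
      the first basis vector plus \<open>w\<close>, that is, \<open>u\<close>.\<close>
    have "w 0 = - s / 2" unfolding s w_def by simp
    then have "c * w i * w 0 = - w i" unfolding c_def using False by simp
    then have "H $$ (i,0) = (if i = 0 then 1 else 0) + w i"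
      unfolding H_def using i n by simp
    then show ?thesis unfolding w_def by simp
  qed
  then show thesis using that H sym HH by blast
qed

text \<open>Deflation: \<open>H\<close> takes the first basis vector to a unit eigenvector, so the
  first column of \<open>H * A * H\<close> is \<open>c\<close> times that basis vector. By symmetry
  this matrix is block diagonal with blocks \<open>c\<close> and \<open>A'\<close>, and the
  induction hypothesis diagonalizes \<open>A'\<close>.\<close>

theorem symmetric_real_orthogonal_diagonalization:
  fixes A :: "real mat"
  assumes "A \<in> carrier_mat n n" "A\<^sup>T = A"
  shows "\<exists>Q a. Q \<in> carrier_mat n n \<and> Q * Q\<^sup>T = 1\<^sub>m n \<and> Q\<^sup>T * Q = 1\<^sub>m n \<and> A = Q * mat_diag n a * Q\<^sup>T"
  using assms
proof (induction n arbitrary: A)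
  case 0
  then show ?case by (intro exI[of _ "1\<^sub>m 0"]) (auto intro!: eq_matI)
next
  case (Suc n)
  note A = Suc.prems(1) and sym = Suc.prems(2)
  obtain u c where Au: "\<And>i. i < Suc n \<Longrightarrow> (\<Sum>k<Suc n. A $$ (i,k) * u k) = c * u i"
    and u: "(\<Sum>i<Suc n. (u i)\<^sup>2) = 1"
    using symmetric_real_eigenvector[OF A sym] by (metis zero_less_Suc)
  obtain H where H: "H \<in> carrier_mat (Suc n) (Suc n)" "H\<^sup>T = H" "H * H = 1\<^sub>m (Suc n)"
    "\<And>i. i < Suc n \<Longrightarrow> H $$ (i,0) = u i"
    using symmetric_orthogonal_with_first_col[OF u] by (metis zero_less_Suc)
  define B where "B = H * A * H"
  have B: "B \<in> carrier_mat (Suc n) (Suc n)" using A H(1) unfolding B_def by simp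
  have dims: "dim_row A = Suc n" "dim_col A = Suc n" "dim_row H = Suc n" "dim_col H = Suc n"
    using A H by auto
  have Bsym: "B\<^sup>T = B"
    unfolding B_def by (simp add: transpose_mult_dim mult_mat_assoc_dim dims sym H(2))
  have Bi0: "B $$ (i,0) = (if i = 0 then c else 0)" if i: "i < Suc n" for i
  proof -
    have AH: "(A * H) $$ (k,0) = c * H $$ (k,0)" if "k < Suc n" for k
      using that Au[OF that] H(4) by (subst index_mult_mat_sum) (auto simp: dims)
    have "B = H * (A * H)" unfolding B_def by (simp add: mult_mat_assoc_dim dims)
    then have "B $$ (i,0) = (\<Sum>k<Suc n. H $$ (i,k) * (A * H) $$ (k,0))"
      using i by (simp only:) (subst index_mult_mat_sum, auto simp: dims)
    also have "\<dots> = c * (\<Sum>k<Suc n. H $$ (i,k) * H $$ (k,0))"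
      unfolding sum_distrib_left by (intro sum.cong refl) (simp add: AH)
    also have "(\<Sum>k<Suc n. H $$ (i,k) * H $$ (k,0)) = (H * H) $$ (i,0)"
      using i by (subst index_mult_mat_sum) (auto simp: dims)
    finally show ?thesis using i H(3) by simp
  qed
  have symB: "B $$ (i,j) = B $$ (j,i)" if "i < Suc n" "j < Suc n" for i j
    using index_transpose_mat(1)[of i B j] B Bsym that by simp
  define A' where "A' = mat n n (\<lambda>(i,j). B $$ (Suc i, Suc j))"
  have A': "A' \<in> carrier_mat n n" unfolding A'_def by simp
  have "A'\<^sup>T = A'" by (rule eq_matI) (auto simp: A'_def symB)
  from Suc.IH[OF A' this] obtain R a where R: "R \<in> carrier_mat n n" "R * R\<^sup>T = 1\<^sub>m n"
    "R\<^sup>T * R = 1\<^sub>m n" and A'R: "A' = R * mat_diag n a * R\<^sup>T" by blast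
  \<comment> \<open>Block diagonal embedding. It respects products, transposes and the identity, so
    the equations for \<open>R\<close> carry over to \<open>emb 1 R\<close>.\<close>
  define emb where "emb x X = four_block_mat (mat 1 1 (\<lambda>_. x)) (0\<^sub>m 1 n) (0\<^sub>m n 1) X"
    for x :: real and X :: "real mat"
  have emb_c: "emb x X \<in> carrier_mat (Suc n) (Suc n)" if "X \<in> carrier_mat n n" for x X
    using that unfolding emb_def by (metis four_block_carrier_mat mat_carrier plus_1_eq_Suc)
  have emb_mult: "emb x X * emb y Y = emb (x * y) (X * Y)"
    if "X \<in> carrier_mat n n" "Y \<in> carrier_mat n n" for x y X Y
  proof -
    have "mat 1 1 (\<lambda>_. x) * mat 1 1 (\<lambda>_. y) = mat 1 1 (\<lambda>_. x * y)"
      by (rule eq_matI) (auto simp: scalar_prod_def)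
    then show ?thesis unfolding emb_def
      by (subst mult_four_block_mat[of _ 1 1 _ n _ n _ _ 1 _ n]) (use that in auto)
  qed
  have emb_t: "(emb x X)\<^sup>T = emb x (X\<^sup>T)" if "X \<in> carrier_mat n n" for x X
    unfolding emb_def
    by (subst transpose_four_block_mat[of _ 1 1 _ n _ n]) (use that in \<open>auto intro!: cong_four_block_mat\<close>)
  have emb_1: "emb 1 (1\<^sub>m n) = 1\<^sub>m (Suc n)"
    unfolding emb_def by (rule eq_matI) auto
  have emb_B: "B = emb c A'"
    unfolding emb_def
  proof (rule eq_matI)
    fix i j assume "i < dim_row (four_block_mat (mat 1 1 (\<lambda>_. c)) (0\<^sub>m 1 n) (0\<^sub>m n 1) A')"
      "j < dim_col (four_block_mat (mat 1 1 (\<lambda>_. c)) (0\<^sub>m 1 n) (0\<^sub>m n 1) A')"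
    then have ij: "i < Suc n" "j < Suc n" using A' by auto
    then show "B $$ (i, j) = four_block_mat (mat 1 1 (\<lambda>_. c)) (0\<^sub>m 1 n) (0\<^sub>m n 1) A' $$ (i, j)"
      using A' Bi0[of i] Bi0[of j] symB[of i j]
      by (cases i; cases j) (auto simp: A'_def)
  qed (use A' B in auto)
  have emb_D: "emb c (mat_diag n a) = mat_diag (Suc n) (case_nat c a)"
    unfolding emb_def
    by (rule eq_matI) (auto simp: mat_diag_def split: nat.splits)
  define Q where "Q = H * emb 1 R"
  have Rt: "R\<^sup>T \<in> carrier_mat n n" and D: "mat_diag n a \<in> carrier_mat n n" using R by auto
  note ec = emb_c[OF R(1)] emb_c[OF Rt] emb_c[OF A'] emb_c[OF D]
  have ed: "dim_row (emb x X) = Suc n" "dim_col (emb x X) = Suc n" if "X \<in> carrier_mat n n" for x X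
    using emb_c[OF that, of x] by auto
  have Q: "Q \<in> carrier_mat (Suc n) (Suc n)" unfolding Q_def using H ec by auto
  have Qt: "Q\<^sup>T = emb 1 (R\<^sup>T) * H"
    unfolding Q_def using R by (simp add: transpose_mult_dim dims ed emb_t H(2))
  have HHX: "H * (H * X) = X" if "X \<in> carrier_mat (Suc n) (Suc n)" for X
    using H(1,3) that by (metis assoc_mult_mat left_mult_one_mat)
  have "Q * Q\<^sup>T = H * (emb 1 R * emb 1 (R\<^sup>T)) * H"
    unfolding Qt unfolding Q_def using R Rt by (simp add: mult_mat_assoc_dim dims ed)
  then have QQ: "Q * Q\<^sup>T = 1\<^sub>m (Suc n)"
    using R Rt H by (simp add: emb_mult emb_1)
  have "Q\<^sup>T * Q = emb 1 (R\<^sup>T) * (H * (H * emb 1 R))"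
    unfolding Qt unfolding Q_def using R Rt by (simp add: mult_mat_assoc_dim dims ed)
  then have QQ': "Q\<^sup>T * Q = 1\<^sub>m (Suc n)"
    using R Rt by (simp add: HHX ec emb_mult emb_1)
  have "Q * mat_diag (Suc n) (case_nat c a) * Q\<^sup>T
      = H * (emb 1 R * emb c (mat_diag n a) * emb 1 (R\<^sup>T)) * H"
    unfolding Qt unfolding Q_def emb_D[symmetric] using R Rt by (simp add: mult_mat_assoc_dim dims ed)
  also have "emb 1 R * emb c (mat_diag n a) * emb 1 (R\<^sup>T) = B"
    unfolding emb_B A'R using R Rt D by (simp add: emb_mult)
  also have "H * B * H = A"
    unfolding B_def using A H(1) by (simp add: mult_mat_assoc_dim dims H(3) HHX)
  finally show ?case using Q QQ QQ' by metis
qed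

subsection \<open>Fractional powers of Gram matrices\<close>

lemma pow_mat_similar:
  fixes Q :: "'a :: comm_ring_1 mat"
  assumes "Q \<in> carrier_mat n n" "D \<in> carrier_mat n n" "Q * Q\<^sup>T = 1\<^sub>m n" "Q\<^sup>T * Q = 1\<^sub>m n"
  shows "(Q * D * Q\<^sup>T) ^\<^sub>m k = Q * D ^\<^sub>m k * Q\<^sup>T"
proof (induction k)
  case 0
  then show ?case using assms by simp
next
  case (Suc k)
  have Dk: "D ^\<^sub>m k \<in> carrier_mat n n" using assms by simp
  have dims: "dim_row Q = n" "dim_col Q = n" "dim_row D = n" "dim_col D = n"
    "dim_row (D ^\<^sub>m k) = n" "dim_col (D ^\<^sub>m k) = n"
    using assms Dk by auto
  have "(Q * D * Q\<^sup>T) ^\<^sub>m Suc k = Q * D ^\<^sub>m k * Q\<^sup>T * (Q * D * Q\<^sup>T)"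
    by (simp only: pow_mat.simps Suc)
  also have "\<dots> = Q * D ^\<^sub>m k * (Q\<^sup>T * Q) * D * Q\<^sup>T"
    by (simp add: mult_mat_assoc_dim dims)
  also have "\<dots> = Q * (D ^\<^sub>m k * D) * Q\<^sup>T"
    using assms(1) Dk by (simp add: mult_mat_assoc_dim dims assms(4))
  finally show ?case by simp
qed

lemma pow_mat_diag: "mat_diag n a ^\<^sub>m k = mat_diag n (\<lambda>i. a i ^ k)"
  by (induction k) (simp_all add: power_Suc2 carrier_matD[OF mat_diag_dim] del: power_Suc)

text \<open>For \<open>a = 0\<close> and \<open>i = 0\<close> this rests on the convention
  \<open>npowr 0 0 = 1\<close>; for \<open>a = 0\<close> and \<open>i > 0\<close> both sides
  vanish.\<close>

lemma npowr_root_pow: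
  assumes "a \<ge> 0" "N \<ge> 1"
  shows "npowr (a ^ N) (real i / real N) = a ^ i"
proof (cases "a = 0")
  case True
  then show ?thesis using assms by (auto simp: npowr_def power_0_left)
next
  case False
  then have a: "a > 0" using assms by simp
  have "(a ^ N) powr (real i / real N) = a powr (real N * (real i / real N))"
    using a by (simp add: powr_powr flip: powr_realpow)
  also have "\<dots> = a ^ i" using a assms by (simp add: powr_realpow)
  finally show ?thesis using assms by (auto simp: npowr_def)
qed

text \<open>One orthogonal \<open>Q\<close> diagonalizes all powers of \<open>X * X\<^sup>T\<close>.
  Its eigenvalues are nonnegative, so the exponent \<open>i / N\<close> turns their
  \<open>N\<close>-th powers into their \<open>i\<close>-th powers. As fractional powers are unique,
  one witness suffices.\<close>

lemma psd_power_pow_mult_transpose: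
  fixes X :: "real mat"
  assumes X: "X \<in> carrier_mat n r" and N: "N \<ge> 1"
  shows "psd_power ((X * X\<^sup>T) ^\<^sub>m N) (real i / real N) = (X * X\<^sup>T) ^\<^sub>m i"
proof (rule psd_power_eqI)
  let ?P = "X * X\<^sup>T"
  have P: "?P \<in> carrier_mat n n" using X by simp
  have "?P\<^sup>T = ?P" using X by (simp add: transpose_mult_dim)
  then obtain Q a where Q: "Q \<in> carrier_mat n n" "Q * Q\<^sup>T = 1\<^sub>m n" "Q\<^sup>T * Q = 1\<^sub>m n"
    and eq: "?P = Q * mat_diag n a * Q\<^sup>T"
    using symmetric_real_orthogonal_diagonalization[OF P] by blast
  have dims: "dim_row Q = n" "dim_col Q = n" "dim_row X = n" "dim_col X = r"
    "dim_row (mat_diag n a) = n" "dim_col (mat_diag n a) = n"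
    using Q X by (auto simp: mat_diag_def)
  \<comment> \<open>Conjugation by \<open>Q\<close> exhibits the diagonal matrix itself as a Gram
    matrix, so its diagonal entries are sums of squares.\<close>
  have D: "mat_diag n a = (Q\<^sup>T * X) * (Q\<^sup>T * X)\<^sup>T"
  proof -
    have "(Q\<^sup>T * X) * (Q\<^sup>T * X)\<^sup>T = Q\<^sup>T * ?P * Q"
      by (simp add: transpose_mult_dim mult_mat_assoc_dim dims)
    also have "\<dots> = (Q\<^sup>T * Q) * mat_diag n a * (Q\<^sup>T * Q)"
      unfolding eq by (simp add: mult_mat_assoc_dim dims)
    also have "\<dots> = mat_diag n a"
      unfolding Q by (simp add: left_mult_one_mat[of _ n n] right_mult_one_mat[of _ n n])
    finally show ?thesis by simp
  qed
  have a: "a i \<ge> 0" if "i < n" for i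
  proof -
    have "a i = mat_diag n a $$ (i,i)" using that by (simp add: mat_diag_def)
    also have "\<dots> = (\<Sum>k<r. ((Q\<^sup>T * X) $$ (i,k))\<^sup>2)"
      unfolding D using that
      by (subst index_mult_mat_sum) (auto simp: dims power2_eq_square intro!: sum.cong)
    finally show ?thesis by (simp add: sum_nonneg)
  qed
  have pow: "?P ^\<^sub>m j = Q * mat_diag n (\<lambda>i. a i ^ j) * Q\<^sup>T" for j
    unfolding eq pow_mat_diag[symmetric] by (rule pow_mat_similar) (use Q in auto)
  have npowr: "mat_diag n (\<lambda>j. npowr (a j ^ N) (real i / real N)) = mat_diag n (\<lambda>j. a j ^ i)"
    using a N by (intro eq_matI) (auto simp: mat_diag_def npowr_root_pow)
  show "is_psd_power (?P ^\<^sub>m N) (real i / real N) (?P ^\<^sub>m i)"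
    unfolding is_psd_power_def
  proof (intro exI conjI allI impI)
    show "?P ^\<^sub>m N = Q * mat_diag n (\<lambda>i. a i ^ N) * Q\<^sup>T" by (rule pow)
    show "?P ^\<^sub>m i = Q * mat_diag n (\<lambda>j. npowr (a j ^ N) (real i / real N)) * Q\<^sup>T"
      unfolding npowr by (rule pow)
  qed (simp_all add: Q a)
qed


subsection \<open>Gradients with respect to matrices\<close>

lemma frob_inner_smult_right: "frob_inner G (c \<cdot>\<^sub>m E) = c * frob_inner G E"
  if "E \<in> carrier_mat (dim_row G) (dim_col G)"
  using that unfolding frob_inner_def sum_distrib_left
  by (intro sum.cong refl) auto

lemma frob_norm_smult: "frob_norm (c \<cdot>\<^sub>m E) = \<bar>c\<bar> * frob_norm E"
proof -
  have "frob_inner (c \<cdot>\<^sub>m E) (c \<cdot>\<^sub>m E) = c\<^sup>2 * frob_inner E E"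
    unfolding frob_inner_def sum_distrib_left
    by (intro sum.cong refl) (auto simp: power2_eq_square)
  then show ?thesis unfolding frob_norm_def by (simp add: real_sqrt_mult)
qed

text \<open>The condition of \<open>mat_differentiable_at\<close> with its bound matrix made a
  parameter, so that the gradient can be named before it is known to be
  \<open>mat_grad f A\<close>.\<close>

definition has_frechet_gradient :: "(real mat \<Rightarrow> real) \<Rightarrow> real mat \<Rightarrow> real mat \<Rightarrow> bool" where
  "has_frechet_gradient f G A \<longleftrightarrow> G \<in> carrier_mat (dim_row A) (dim_col A) \<and>
     (\<forall>e>0. \<exists>\<delta>>0. \<forall>H \<in> carrier_mat (dim_row A) (dim_col A). frob_norm H < \<delta> \<longrightarrow>
          \<bar>f (A + H) - f A - frob_inner G H\<bar> \<le> e * frob_norm H)"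

text \<open>The parameter is shifted by \<open>c\<close> because \<open>mat_grad\<close>
  differentiates at the current value of an entry and not at 0.\<close>

lemma has_frechet_gradient_directional:
  assumes G: "has_frechet_gradient f G A"
    and E: "E \<in> carrier_mat (dim_row A) (dim_col A)"
  shows "((\<lambda>s. f (A + (s - c) \<cdot>\<^sub>m E)) has_real_derivative frob_inner G E) (at c)"
proof -
  have Gc: "G \<in> carrier_mat (dim_row A) (dim_col A)"
    using G unfolding has_frechet_gradient_def by blast
  then have EG: "E \<in> carrier_mat (dim_row G) (dim_col G)" using E by auto
  have A0: "A + (0::real) \<cdot>\<^sub>m E = A" using E by (intro eq_matI) auto
  have nn: "frob_norm E \<ge> 0"
    unfolding frob_norm_def frob_inner_def by (simp add: sum_nonneg)
  have "((\<lambda>h. f (A + h \<cdot>\<^sub>m E)) has_real_derivative frob_inner G E) (at 0)"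
    unfolding DERIV_def LIM_def
  proof (intro allI impI)
    fix r :: real assume r: "r > 0"
    \<comment> \<open>The summand 1 keeps the denominator positive when \<open>E\<close> is
      zero.\<close>
    define e where "e = r / (2 * (frob_norm E + 1))"
    have e: "e > 0" "e * frob_norm E < r"
      using r nn unfolding e_def by (auto simp: field_simps intro!: add_nonneg_pos)
    obtain \<delta> where \<delta>: "\<delta> > 0" and d: "\<And>H. H \<in> carrier_mat (dim_row A) (dim_col A) \<Longrightarrow>
        frob_norm H < \<delta> \<Longrightarrow> \<bar>f (A + H) - f A - frob_inner G H\<bar> \<le> e * frob_norm H"
      using G e(1) unfolding has_frechet_gradient_def by meson
    show "\<exists>s>0. \<forall>h. h \<noteq> 0 \<and> dist h 0 < s \<longrightarrow>
       dist ((f (A + (0 + h) \<cdot>\<^sub>m E) - f (A + 0 \<cdot>\<^sub>m E)) / h) (frob_inner G E) < r"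
    proof (intro exI[of _ "\<delta> / (frob_norm E + 1)"] conjI allI impI)
      show "\<delta> / (frob_norm E + 1) > 0" using \<delta> nn by simp
      fix h :: real assume h: "h \<noteq> 0 \<and> dist h 0 < \<delta> / (frob_norm E + 1)"
      then have "\<bar>h\<bar> * (frob_norm E + 1) < \<delta>" using nn by (simp add: field_simps)
      then have "\<bar>h\<bar> * frob_norm E < \<delta>" by (simp add: algebra_simps)
      then have "\<bar>f (A + h \<cdot>\<^sub>m E) - f A - h * frob_inner G E\<bar> \<le> e * (\<bar>h\<bar> * frob_norm E)"
        using d[of "h \<cdot>\<^sub>m E"] E EG by (simp add: frob_norm_smult frob_inner_smult_right)
      also have "\<dots> = \<bar>h\<bar> * (e * frob_norm E)" by simp
      also have "\<dots> < \<bar>h\<bar> * r" using h e(2) by (intro mult_strict_left_mono) auto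
      finally have "\<bar>f (A + h \<cdot>\<^sub>m E) - f A - h * frob_inner G E\<bar> / \<bar>h\<bar> < r"
        using h by (simp add: field_simps)
      also have "\<bar>f (A + h \<cdot>\<^sub>m E) - f A - h * frob_inner G E\<bar> / \<bar>h\<bar>
          = \<bar>(f (A + h \<cdot>\<^sub>m E) - f A) / h - frob_inner G E\<bar>"
        using h by (simp add: diff_divide_distrib flip: abs_divide)
      finally show "dist ((f (A + (0 + h) \<cdot>\<^sub>m E) - f (A + 0 \<cdot>\<^sub>m E)) / h) (frob_inner G E) < r"
        by (simp add: A0 dist_real_def)
    qed
  qed
  then have "((\<lambda>h. f (A + ((h + c) - c) \<cdot>\<^sub>m E)) has_real_derivative frob_inner G E) (at 0)"
    by simp
  then show ?thesis
    using DERIV_shift[of "\<lambda>s. f (A + (s - c) \<cdot>\<^sub>m E)" _ 0 c] by simp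
qed


text \<open>Changing entry \<open>(i,j)\<close> of \<open>M\<close> moves \<open>A * M * B\<close>
  along the outer product \<open>E\<close> of column \<open>i\<close> of \<open>A\<close> and row
  \<open>j\<close> of \<open>B\<close>. The Frobenius product of \<open>G\<close> and
  \<open>E\<close> is entry \<open>(i,j)\<close> of
  \<open>A\<^sup>T * G * B\<^sup>T\<close>.\<close>

lemma mat_grad_compose_frechet:
  assumes A: "A \<in> carrier_mat k p" and B: "B \<in> carrier_mat q d" and M: "M \<in> carrier_mat p q"
    and G: "has_frechet_gradient f G (A * M * B)"
  shows "mat_grad (\<lambda>X. f (A * X * B)) M = A\<^sup>T * G * B\<^sup>T"
proof (rule eq_matI)
  have Gc: "G \<in> carrier_mat k d" using G A B M unfolding has_frechet_gradient_def by auto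
  show "dim_row (mat_grad (\<lambda>X. f (A * X * B)) M) = dim_row (A\<^sup>T * G * B\<^sup>T)"
    "dim_col (mat_grad (\<lambda>X. f (A * X * B)) M) = dim_col (A\<^sup>T * G * B\<^sup>T)"
    using A B M Gc by (auto simp: mat_grad_def)
  fix i j assume "i < dim_row (A\<^sup>T * G * B\<^sup>T)" "j < dim_col (A\<^sup>T * G * B\<^sup>T)"
  then have ij: "i < p" "j < q" using A B by auto
  define E where "E = mat k d (\<lambda>(a,b). A $$ (a,i) * B $$ (j,b))"
  have E: "E \<in> carrier_mat k d" unfolding E_def by simp
  have upd: "A * update_mat M (i,j) x * B = A * M * B + (x - M $$ (i,j)) \<cdot>\<^sub>m E" for x
  proof -
    define U where "U = mat p q (\<lambda>ab. if ab = (i,j) then 1 else 0 :: real)"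
    have U: "U \<in> carrier_mat p q" unfolding U_def by simp
    have "update_mat M (i,j) x = M + (x - M $$ (i,j)) \<cdot>\<^sub>m U"
      using M ij by (intro eq_matI) (auto simp: update_mat_def U_def)
    then have "A * update_mat M (i,j) x * B = A * M * B + (x - M $$ (i,j)) \<cdot>\<^sub>m (A * U * B)"
      using A B M U
      by (simp add: mult_add_distrib_mat[of _ k p _ q] add_mult_distrib_mat[of _ k q _ _ d]
          mult_smult_distrib[of _ k p _ q] mult_smult_assoc_mat[of _ k q _ d])
    moreover have "A * U * B = E"
    proof (rule eq_matI)
      fix a b assume "a < dim_row E" "b < dim_col E"
      then have ab: "a < k" "b < d" using E by auto
      have AU: "(A * U) $$ (a,c) = (if c = j then A $$ (a,i) else 0)" if "c < q" for c
      proof -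
        have "(A * U) $$ (a,c) = (\<Sum>l<p. A $$ (a,l) * U $$ (l,c))"
          using that ab A U by (subst index_mult_mat_sum) auto
        also have "\<dots> = (\<Sum>l<p. if l = i then (if c = j then A $$ (a,i) else 0) else 0)"
          using that by (intro sum.cong) (auto simp: U_def)
        finally show ?thesis using ij by simp
      qed
      have "(A * U * B) $$ (a,b) = (\<Sum>c<q. (A * U) $$ (a,c) * B $$ (c,b))"
        using ab A B U by (subst index_mult_mat_sum) auto
      also have "\<dots> = (\<Sum>c<q. if c = j then A $$ (a,i) * B $$ (j,b) else 0)"
        by (intro sum.cong) (auto simp: AU simp del: index_mult_mat(1))
      finally show "(A * U * B) $$ (a,b) = E $$ (a,b)" using ij ab by (simp add: E_def)
    qed (use A B E in auto)
    ultimately show ?thesis by simp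
  qed
  have "((\<lambda>x. f (A * update_mat M (i,j) x * B)) has_real_derivative frob_inner G E) (at (M $$ (i,j)))"
    unfolding upd by (rule has_frechet_gradient_directional[OF G]) (use A B E in auto)
  then have "mat_grad (\<lambda>X. f (A * X * B)) M $$ (i,j) = frob_inner G E"
    using M ij by (simp add: mat_grad_def DERIV_imp_deriv)
  also have "\<dots> = (\<Sum>b<d. \<Sum>a<k. A $$ (a,i) * G $$ (a,b) * B $$ (j,b))"
    unfolding frob_inner_def E_def using Gc
    by (subst sum.swap) (auto intro!: sum.cong)
  also have "\<dots> = (A\<^sup>T * G * B\<^sup>T) $$ (i,j)"
    using ij A B Gc
    by (subst index_mult_mat_sum, simp_all del: index_mult_mat(1), intro sum.cong refl,
        subst index_mult_mat_sum, auto simp: sum_distrib_right)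
  finally show "mat_grad (\<lambda>X. f (A * X * B)) M $$ (i,j) = (A\<^sup>T * G * B\<^sup>T) $$ (i,j)" .
qed

text \<open>Partial derivatives at \<open>M\<close> see only matrices of its format. This matters
  because the network factors around a layer only for a weight of the right format.\<close>

lemma mat_grad_cong:
  assumes "\<And>X. X \<in> carrier_mat (dim_row M) (dim_col M) \<Longrightarrow> f X = g X"
  shows "mat_grad f M = mat_grad g M"
proof -
  have "f (update_mat M ij x) = g (update_mat M ij x)" for ij x
    by (rule assms) (auto simp: update_mat_def)
  then show ?thesis unfolding mat_grad_def by simp
qed

lemma mat_grad_compose:
  assumes A: "A \<in> carrier_mat k p" and B: "B \<in> carrier_mat q d" and M: "M \<in> carrier_mat p q"
    and f: "mat_differentiable_at f (A * M * B)"
  shows "mat_grad (\<lambda>X. f (A * X * B)) M = A\<^sup>T * mat_grad f (A * M * B) * B\<^sup>T"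
proof -
  obtain G where G: "has_frechet_gradient f G (A * M * B)"
    using f unfolding mat_differentiable_at_def has_frechet_gradient_def by blast
  then have Gc: "G \<in> carrier_mat k d" using A B unfolding has_frechet_gradient_def by auto
  have X: "A * M * B \<in> carrier_mat k d" using A B by auto
  \<comment> \<open>identity factors: the Frechet gradient is the matrix of partial derivatives\<close>
  have "mat_grad f (A * M * B) = mat_grad (\<lambda>X. f (1\<^sub>m k * X * 1\<^sub>m d)) (A * M * B)"
    by (rule mat_grad_cong) (use A B in auto)
  also have "\<dots> = G"
    using mat_grad_compose_frechet[of "1\<^sub>m k" k k "1\<^sub>m d" d d _ f G, OF _ _ X] G Gc
      left_mult_one_mat[OF X] right_mult_one_mat[OF X] by simp
  finally show ?thesis using mat_grad_compose_frechet[OF A B M G] by simp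
qed

subsection \<open>Products of consecutive weight matrices\<close>

text \<open>Regrouping of an alternating product; it drives the telescoping of Gram
  matrices.\<close>

lemma mult_pow_mat_shift:
  fixes A B :: "'a :: comm_ring_1 mat"
  assumes A: "A \<in> carrier_mat r c" and B: "B \<in> carrier_mat c r"
  shows "A * (B * A) ^\<^sub>m p * B = (A * B) ^\<^sub>m Suc p"
proof (induction p)
  case 0
  then show ?case using A B by simp
next
  case (Suc p)
  have BA: "(B * A) ^\<^sub>m p \<in> carrier_mat c c" using A B by (intro pow_carrier_mat) simp
  have dims: "dim_row A = r" "dim_col A = c" "dim_row B = c" "dim_col B = r"
    "dim_row ((B * A) ^\<^sub>m p) = c" "dim_col ((B * A) ^\<^sub>m p) = c"
    using A B BA by auto
  have "A * (B * A) ^\<^sub>m Suc p * B = (A * (B * A) ^\<^sub>m p * B) * (A * B)"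
    by (simp add: mult_mat_assoc_dim dims)
  then show ?case unfolding Suc by simp
qed

text \<open>The product of the layers \<open>i + 1\<close> to \<open>i + p\<close>, the last on the
  left. The widths \<open>n\<close> give the empty product its size, as it has no factor to read it
  from.\<close>

fun layer_prod :: "(nat \<Rightarrow> nat) \<Rightarrow> (nat \<Rightarrow> real mat) \<Rightarrow> nat \<Rightarrow> nat \<Rightarrow> real mat" where
  "layer_prod n V i 0 = 1\<^sub>m (n i)"
| "layer_prod n V i (Suc p) = V (i + Suc p) * layer_prod n V i p"

lemma layer_prod_cong:
  assumes "\<And>j. i < j \<Longrightarrow> j \<le> i + p \<Longrightarrow> V j = V' j"
  shows "layer_prod n V i p = layer_prod n V' i p"
  using assms by (induction p) auto

lemma end_to_end_eq_layer_prod: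
  assumes "dim_col (V 1) = n 0"
  shows "end_to_end V p = layer_prod n V 0 p"
  using assms by (induction p) auto

locale layered_weights =
  fixes N :: nat and n :: "nat \<Rightarrow> nat" and V :: "nat \<Rightarrow> real mat"
  assumes weight_carrier: "1 \<le> j \<Longrightarrow> j \<le> N \<Longrightarrow> V j \<in> carrier_mat (n j) (n (j - 1))"
begin

abbreviation "P \<equiv> layer_prod n V"

lemma weight_dims [simp]:
  assumes "1 \<le> j" "j \<le> N"
  shows "dim_row (V j) = n j" "dim_col (V j) = n (j - 1)"
  using weight_carrier[OF assms] by auto

lemma layer_prod_carrier:
  assumes "i + p \<le> N"
  shows "P i p \<in> carrier_mat (n (i + p)) (n i)"
  using assms
proof (induction p)
  case (Suc p)
  then show ?case using weight_carrier[of "i + Suc p"] by (auto simp del: One_nat_def)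
qed simp

lemma layer_prod_dims [simp]:
  assumes "i + p \<le> N"
  shows "dim_row (P i p) = n (i + p)" "dim_col (P i p) = n i"
  using layer_prod_carrier[OF assms] by auto

lemma layer_prod_add:
  assumes "i + p + q \<le> N"
  shows "P i (p + q) = P (i + p) q * P i p"
  using assms
proof (induction q)
  case 0
  then show ?case using layer_prod_carrier[of i p] by simp
next
  case (Suc q)
  then show ?case by (simp add: mult_mat_assoc_dim add.assoc)
qed

lemma layer_prod_Suc_right:
  assumes "Suc (i + p) \<le> N"
  shows "P i (Suc p) = P (Suc i) p * V (Suc i)"
  using layer_prod_add[of i 1 p] weight_carrier[of "Suc i"] assms by simp

lemma layer_prod_factor:
  assumes j: "1 \<le> j" "j \<le> N"
  shows "P 0 N = P j (N - j) * V j * P 0 (j - 1)"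
proof -
  obtain i where i: "j = Suc i" using j by (cases j) auto
  have "P 0 N = P 0 (j + (N - j))" using j by simp
  also have "\<dots> = P j (N - j) * P 0 j" using j by (subst layer_prod_add) auto
  finally show ?thesis using j by (simp add: i mult_mat_assoc_dim)
qed

text \<open>As a function of layer \<open>j\<close> alone the end-to-end matrix is
  \<open>A * X * B\<close>, with the layers after and before \<open>j\<close> as constant factors,
  so \<open>mat_grad_compose\<close> applies.\<close>

lemma deep_loss_grad_eq:
  assumes j: "1 \<le> j" "j \<le> N" and f: "mat_differentiable_at f (P 0 N)"
  shows "deep_loss_grad f N j V = (P j (N - j))\<^sup>T * mat_grad f (P 0 N) * (P 0 (j - 1))\<^sup>T"
proof -
  have "deep_loss f N (V(j := X)) = f (P j (N - j) * X * P 0 (j - 1))"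
    if X: "X \<in> carrier_mat (n j) (n (j - 1))" for X
  proof -
    \<comment> \<open>The factorization is needed for the altered weights. Neither outer factor
      contains layer \<open>j\<close>, so both revert to products of \<open>V\<close>.\<close>
    interpret L: layered_weights N n "V(j := X)"
      by standard (use weight_carrier X in auto)
    have "end_to_end (V(j := X)) N = L.P 0 N"
      by (rule end_to_end_eq_layer_prod) (use X j weight_carrier[of 1] in auto)
    also have "\<dots> = L.P j (N - j) * X * L.P 0 (j - 1)"
      using L.layer_prod_factor[OF j] by simp
    also have "L.P j (N - j) = P j (N - j)" by (rule layer_prod_cong) auto
    also have "L.P 0 (j - 1) = P 0 (j - 1)" by (rule layer_prod_cong) auto
    finally show ?thesis by (simp only: deep_loss_def)
  qed
  then have "deep_loss_grad f N j V = mat_grad (\<lambda>X. f (P j (N - j) * X * P 0 (j - 1))) (V j)"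
    unfolding deep_loss_grad_def by (intro mat_grad_cong) (use weight_carrier[OF j] in auto)
  also have "\<dots> = (P j (N - j))\<^sup>T * mat_grad f (P 0 N) * (P 0 (j - 1))\<^sup>T"
    using mat_grad_compose[OF layer_prod_carrier layer_prod_carrier, of j "N - j" 0 "j - 1" "V j" f]
      weight_carrier[OF j] f j layer_prod_factor[OF j] by simp
  finally show ?thesis .
qed

text \<open>Both sides equal the transposed product of the layers after \<open>j\<close>, times
  \<open>G\<close>, times the transposed product of the layers up to \<open>j\<close>: on the left
  \<open>V (j + 1)\<close> joins the first factor, on the right \<open>V j\<close> joins the
  last.\<close>

lemma layer_grad_exchange:
  assumes j: "1 \<le> j" "j < N" and G: "G \<in> carrier_mat (n N) (n 0)"
  shows "(V (j + 1))\<^sup>T * ((P (j + 1) (N - (j + 1)))\<^sup>T * G * (P 0 j)\<^sup>T)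
      = (P j (N - j))\<^sup>T * G * (P 0 (j - 1))\<^sup>T * (V j)\<^sup>T"
proof -
  have N: "N - j = Suc (N - (j + 1))" using j by simp
  have 1: "P j (N - j) = P (j + 1) (N - (j + 1)) * V (j + 1)"
    unfolding N using j by (subst layer_prod_Suc_right) auto
  have 2: "P 0 j = V j * P 0 (j - 1)" using j by (cases j) auto
  show ?thesis unfolding 1 2 using j G
    by (simp add: transpose_mult_dim mult_mat_assoc_dim)
qed

section \<open>Gram matrices of partial products of balanced weights\<close>

context
  assumes balanced: "\<And>j. 1 \<le> j \<Longrightarrow> j < N \<Longrightarrow> (V (j + 1))\<^sup>T * V (j + 1) = V j * (V j)\<^sup>T"
begin

text \<open>Splitting off the last layer \<open>X\<close> leaves \<open>X * M * X\<^sup>T\<close>,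
  where \<open>M\<close> is by induction a power of the Gram matrix of the layer before.
  Balancedness makes it a power of \<open>X\<^sup>T * X\<close>, and
  \<open>mult_pow_mat_shift\<close> gives the next power of \<open>X * X\<^sup>T\<close>.\<close>

lemma layer_prod_gram_left:
  assumes "1 \<le> i + p" "i + p \<le> N"
  shows "P i p * (P i p)\<^sup>T = (V (i + p) * (V (i + p))\<^sup>T) ^\<^sub>m p"
  using assms
proof (induction p)
  case 0
  then show ?case by simp
next
  case (Suc p)
  let ?X = "V (i + Suc p)"
  have X: "?X \<in> carrier_mat (n (i + Suc p)) (n (i + p))" using weight_carrier[of "i + Suc p"] Suc by simp
  have gram: "P i p * (P i p)\<^sup>T = (?X\<^sup>T * ?X) ^\<^sub>m p"
  proof (cases "i + p = 0")
    \<comment> \<open>There is no layer before \<open>X\<close> to balance against, but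
      \<open>p = 0\<close> and both sides are the identity.\<close>
    case True
    then show ?thesis using X by simp
  next
    case False
    then have "1 \<le> i + p" by linarith
    then have "P i p * (P i p)\<^sup>T = (V (i + p) * (V (i + p))\<^sup>T) ^\<^sub>m p"
      and "(V (i + p + 1))\<^sup>T * V (i + p + 1) = V (i + p) * (V (i + p))\<^sup>T"
      using Suc.IH Suc.prems(2) balanced by auto
    then show ?thesis by simp
  qed
  have "P i (Suc p) * (P i (Suc p))\<^sup>T = ?X * (P i p * (P i p)\<^sup>T) * ?X\<^sup>T"
    using Suc X by (simp add: transpose_mult_dim mult_mat_assoc_dim)
  then show ?case unfolding gram using mult_pow_mat_shift[OF X, of "?X\<^sup>T"] X by simp
qed

text \<open>Mirror image of \<open>layer_prod_gram_left\<close>: the first layer is split off, so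
  the start \<open>i\<close> varies in the induction.\<close>

lemma layer_prod_gram_right:
  assumes "i < N" "i + p \<le> N"
  shows "(P i p)\<^sup>T * P i p = ((V (Suc i))\<^sup>T * V (Suc i)) ^\<^sub>m p"
  using assms
proof (induction p arbitrary: i)
  case 0
  then show ?case by simp
next
  case (Suc p)
  let ?X = "V (Suc i)"
  have X: "?X \<in> carrier_mat (n (Suc i)) (n i)" using weight_carrier[of "Suc i"] Suc by simp
  have gram: "(P (Suc i) p)\<^sup>T * P (Suc i) p = (?X * ?X\<^sup>T) ^\<^sub>m p"
  proof (cases "Suc i = N")
    case True
    then have "p = 0" using Suc.prems by simp
    then show ?thesis using X Suc by simp
  next
    case False
    then show ?thesis using Suc balanced[of "Suc i"] by simp
  qed
  have "(P i (Suc p))\<^sup>T * P i (Suc p) = ?X\<^sup>T * ((P (Suc i) p)\<^sup>T * P (Suc i) p) * ?X"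
    using Suc X by (simp add: layer_prod_Suc_right transpose_mult_dim mult_mat_assoc_dim del: layer_prod.simps)
  then show ?case unfolding gram using mult_pow_mat_shift[of "?X\<^sup>T" _ _ ?X] X by simp
qed

text \<open>This is the contribution of layer \<open>q\<close> to the product rule. The Gram
  matrices of the whole product and of the layers after \<open>q\<close> are the powers
  \<open>N\<close> and \<open>N - q\<close> of \<open>V N * (V N)\<^sup>T\<close>, which gives the
  left exponent; on the right \<open>(V 1)\<^sup>T * V 1\<close> plays this part.\<close>

lemma layer_grad_preconditioned:
  assumes q: "1 \<le> q" "q \<le> N" and G: "G \<in> carrier_mat (n N) (n 0)"
  shows "P q (N - q) * ((P q (N - q))\<^sup>T * G * (P 0 (q - 1))\<^sup>T) * P 0 (q - 1)
    = psd_power (P 0 N * (P 0 N)\<^sup>T) (real (N - q) / real N) * G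
      * psd_power ((P 0 N)\<^sup>T * P 0 N) (real (q - 1) / real N)"
proof -
  have N: "N \<ge> 1" using q by simp
  have VN: "V N \<in> carrier_mat (n N) (n (N - 1))" using weight_carrier[of N] N by simp
  have V1: "(V 1)\<^sup>T \<in> carrier_mat (n 0) (n 1)" using weight_carrier[of 1] N by simp
  have "P 0 N * (P 0 N)\<^sup>T = (V N * (V N)\<^sup>T) ^\<^sub>m N"
    using layer_prod_gram_left[of 0 N] N by simp
  then have L: "psd_power (P 0 N * (P 0 N)\<^sup>T) (real (N - q) / real N) = P q (N - q) * (P q (N - q))\<^sup>T"
    using psd_power_pow_mult_transpose[OF VN N] layer_prod_gram_left[of q "N - q"] q
    by (simp del: of_nat_diff)
  have "(P 0 N)\<^sup>T * P 0 N = ((V 1)\<^sup>T * V 1) ^\<^sub>m N"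
    using layer_prod_gram_right[of 0 N] N by simp
  then have R: "psd_power ((P 0 N)\<^sup>T * P 0 N) (real (q - 1) / real N) = (P 0 (q - 1))\<^sup>T * P 0 (q - 1)"
    using psd_power_pow_mult_transpose[OF V1 N] layer_prod_gram_right[of 0 "q - 1"] q
    by (simp del: of_nat_diff)
  show ?thesis unfolding L R using q G by (simp add: mult_mat_assoc_dim)
qed

end

end

subsection \<open>Matrix-valued derivatives\<close>

text \<open>Integrating factor: \<open>y t * exp (- c * t)\<close> has derivative zero on the
  interval and keeps its initial value 0.\<close>

lemma linear_ode_zero:
  fixes y :: "real \<Rightarrow> real"
  assumes T: "is_interval T" and t0: "t0 \<in> T" "y t0 = 0"
    and y: "\<And>t. t \<in> T \<Longrightarrow> (y has_real_derivative c * y t) (at t within T)"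
    and t: "t \<in> T"
  shows "y t = 0"
proof -
  have "((\<lambda>t. y t * exp (- c * t)) has_real_derivative 0) (at s within T)" if s: "s \<in> T" for s
  proof -
    have "((\<lambda>t. exp (- c * t)) has_real_derivative - c * exp (- c * s)) (at s within T)"
      by (auto intro!: derivative_eq_intros)
    from DERIV_mult[OF y[OF s] this] show ?thesis by (simp add: mult.commute mult.left_commute)
  qed
  from has_field_derivative_zero_constant[OF is_interval_convex[OF T] this]
  have "y t * exp (- c * t) = y t0 * exp (- c * t0)" using t t0(1) by auto
  then show ?thesis using t0(2) by simp
qed

lemma has_mat_derivative_within_cong:
  assumes F: "has_mat_derivative_within F D t T" and t: "t \<in> T" and eq: "\<And>s. s \<in> T \<Longrightarrow> F s = G s"
  shows "has_mat_derivative_within G D t T"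
proof -
  have "((\<lambda>s. G s $$ (i,j)) has_real_derivative D $$ (i,j)) (at t within T)"
    if "i < dim_row D" "j < dim_col D" for i j
    by (rule has_field_derivative_transform_within[of "\<lambda>s. F s $$ (i,j)" _ _ _ 1])
       (use F t eq that in \<open>auto simp: has_mat_derivative_within_def\<close>)
  then show ?thesis using F eq unfolding has_mat_derivative_within_def by auto
qed

lemma has_mat_derivative_within_mult:
  assumes F: "has_mat_derivative_within F D t T" and G: "has_mat_derivative_within G E t T"
    and t: "t \<in> T" and dim: "dim_col D = dim_row E"
  shows "has_mat_derivative_within (\<lambda>s. F s * G s) (D * G t + F t * E) t T"
proof -
  have Fc: "F s \<in> carrier_mat (dim_row D) (dim_col D)" and Gc: "G s \<in> carrier_mat (dim_row E) (dim_col E)"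
    if "s \<in> T" for s
    using F G that unfolding has_mat_derivative_within_def by auto
  have entry: "((\<lambda>s. (F s * G s) $$ (i,j)) has_real_derivative (D * G t + F t * E) $$ (i,j)) (at t within T)"
    if ij: "i < dim_row D" "j < dim_col E" for i j
  proof -
    have FG: "(F s * G s) $$ (i,j) = (\<Sum>k<dim_row E. F s $$ (i,k) * G s $$ (k,j))" if "s \<in> T" for s
      using Fc[OF that] Gc[OF that] ij dim by (subst index_mult_mat_sum) auto
    have "((\<lambda>s. \<Sum>k<dim_row E. F s $$ (i,k) * G s $$ (k,j)) has_real_derivative
        (\<Sum>k<dim_row E. D $$ (i,k) * G t $$ (k,j) + E $$ (k,j) * F t $$ (i,k))) (at t within T)"
      using F G ij dim unfolding has_mat_derivative_within_def
      by (intro DERIV_sum DERIV_mult) auto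
    also have "(\<Sum>k<dim_row E. D $$ (i,k) * G t $$ (k,j) + E $$ (k,j) * F t $$ (i,k))
        = (D * G t) $$ (i,j) + (F t * E) $$ (i,j)"
      using ij dim Fc[OF t] Gc[OF t]
      by (subst (1 2) index_mult_mat_sum) (auto simp: sum.distrib mult.commute)
    also have "\<dots> = (D * G t + F t * E) $$ (i,j)"
      using ij dim Fc[OF t] Gc[OF t] by (simp del: index_mult_mat(1))
    finally show ?thesis
      by (rule has_field_derivative_transform_within[of _ _ _ _ 1]) (use FG t in auto)
  qed
  have dims: "dim_row (D * G t + F t * E) = dim_row D" "dim_col (D * G t + F t * E) = dim_col E"
    using Fc[OF t] by auto
  show ?thesis
    unfolding has_mat_derivative_within_def dims
  proof (intro conjI ballI allI impI entry)
    show "F s * G s \<in> carrier_mat (dim_row D) (dim_col E)" if "s \<in> T" for s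
      by (rule mult_carrier_mat[OF Fc[OF that]]) (use Gc[OF that] dim in simp)
  qed
qed

lemma has_mat_derivative_within_transpose:
  assumes F: "has_mat_derivative_within F D t T" and t: "t \<in> T"
  shows "has_mat_derivative_within (\<lambda>s. (F s)\<^sup>T) (D\<^sup>T) t T"
proof -
  have "((\<lambda>s. (F s)\<^sup>T $$ (i,j)) has_real_derivative D $$ (j,i)) (at t within T)"
    if "i < dim_col D" "j < dim_row D" for i j
    by (rule has_field_derivative_transform_within[of "\<lambda>s. F s $$ (j,i)" _ _ _ 1])
       (use F t that in \<open>auto simp: has_mat_derivative_within_def\<close>)
  then show ?thesis using F unfolding has_mat_derivative_within_def by auto
qed

lemma has_mat_derivative_within_diff:
  assumes F: "has_mat_derivative_within F D t T" and G: "has_mat_derivative_within G E t T"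
    and t: "t \<in> T" and dim: "dim_row D = dim_row E" "dim_col D = dim_col E"
  shows "has_mat_derivative_within (\<lambda>s. F s - G s) (D - E) t T"
proof -
  have "((\<lambda>s. (F s - G s) $$ (i,j)) has_real_derivative D $$ (i,j) - E $$ (i,j)) (at t within T)"
    if "i < dim_row D" "j < dim_col D" for i j
    by (rule has_field_derivative_transform_within[of "\<lambda>s. F s $$ (i,j) - G s $$ (i,j)" _ _ _ 1])
       (use F G t dim that in \<open>auto simp: has_mat_derivative_within_def intro!: DERIV_diff\<close>)
  then show ?thesis using F G dim unfolding has_mat_derivative_within_def
    by (auto intro!: minus_carrier_mat)
qed

text \<open>Induction with the last layer split off by the product rule for two factors. Matrices of
  different formats share no zero, so the sum is formed entry by entry.\<close>

lemma has_mat_derivative_within_layer_prod: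
  assumes W: "\<And>j. 1 \<le> j \<Longrightarrow> j \<le> p \<Longrightarrow> has_mat_derivative_within (W j) (D j) t T"
    and D: "\<And>j. 1 \<le> j \<Longrightarrow> j \<le> p \<Longrightarrow> D j \<in> carrier_mat (n j) (n (j - 1))"
    and t: "t \<in> T"
  defines "P \<equiv> layer_prod n (\<lambda>i. W i t)"
  shows "has_mat_derivative_within (\<lambda>s. layer_prod n (\<lambda>i. W i s) 0 p)
    (mat (n p) (n 0) (\<lambda>ab. \<Sum>q\<in>{1..p}. (P q (p - q) * D q * P 0 (q - 1)) $$ ab)) t T"
  using W D
proof (induction p)
  case 0
  then show ?case by (auto simp: has_mat_derivative_within_def)
next
  case (Suc p)
  let ?S = "\<lambda>p ab. \<Sum>q\<in>{1..p}. (P q (p - q) * D q * P 0 (q - 1)) $$ ab"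
  let ?W = "W (Suc p) t"
  interpret layered_weights "Suc p" n "\<lambda>i. W i t"
  proof
    fix j assume j: "1 \<le> j" "j \<le> Suc p"
    then show "W j t \<in> carrier_mat (n j) (n (j - 1))"
      using Suc.prems(1)[OF j] Suc.prems(2)[OF j] t unfolding has_mat_derivative_within_def by auto
  qed
  have Wc: "?W \<in> carrier_mat (n (Suc p)) (n p)" using weight_carrier[of "Suc p"] by simp
  have Dc: "D (Suc p) \<in> carrier_mat (n (Suc p)) (n p)" using Suc.prems(2)[of "Suc p"] by simp
  have Pc: "P 0 p \<in> carrier_mat (n p) (n 0)" unfolding P_def using layer_prod_carrier[of 0 p] by simp
  have Pd: "dim_row (P i k) = n (i + k)" "dim_col (P i k) = n i" if "i + k \<le> Suc p" for i k
    unfolding P_def using layer_prod_dims[OF that] by auto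
  have "has_mat_derivative_within (\<lambda>s. W (Suc p) s * layer_prod n (\<lambda>i. W i s) 0 p)
      (D (Suc p) * P 0 p + ?W * mat (n p) (n 0) (?S p)) t T"
    unfolding P_def
    by (rule has_mat_derivative_within_mult) (use Suc.IH Suc.prems Dc t in \<open>auto simp: P_def\<close>)
  moreover have "D (Suc p) * P 0 p + ?W * mat (n p) (n 0) (?S p)
      = mat (n (Suc p)) (n 0) (?S (Suc p))"
  proof (rule eq_matI)
    fix a b assume "a < dim_row (mat (n (Suc p)) (n 0) (?S (Suc p)))"
      "b < dim_col (mat (n (Suc p)) (n 0) (?S (Suc p)))"
    then have ab: "a < n (Suc p)" "b < n 0" by auto
    \<comment> \<open>Multiplication by the new layer prolongs the left factor of each old summand;
      the new summand \<open>q = p + 1\<close> has an empty left factor.\<close>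
    have step: "(\<Sum>k<n p. ?W $$ (a,k) * (P q (p - q) * D q * P 0 (q - 1)) $$ (k,b))
        = (P q (Suc p - q) * D q * P 0 (q - 1)) $$ (a,b)" if q: "q \<in> {1..p}" for q
    proof -
      have dims: "dim_row (D q) = n q" "dim_col (D q) = n (q - 1)"
        "dim_row (P q (p - q)) = n p" "dim_col (P q (p - q)) = n q"
        "dim_row (P 0 (q - 1)) = n (q - 1)" "dim_col (P 0 (q - 1)) = n 0"
        "dim_row ?W = n (Suc p)" "dim_col ?W = n p"
        using Suc.prems(2)[of q] q Wc Pd[of q "p - q"] Pd[of 0 "q - 1"] by auto
      have "P q (Suc p - q) = ?W * P q (p - q)"
        using q by (simp add: P_def Suc_diff_le)
      then have "P q (Suc p - q) * D q * P 0 (q - 1) = ?W * (P q (p - q) * D q * P 0 (q - 1))"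
        by (simp only: mult_mat_assoc_dim dims index_mult_mat(2,3))
      moreover have "(?W * (P q (p - q) * D q * P 0 (q - 1))) $$ (a,b)
          = (\<Sum>k<n p. ?W $$ (a,k) * (P q (p - q) * D q * P 0 (q - 1)) $$ (k,b))"
        using ab by (subst index_mult_mat_sum) (simp_all only: dims index_mult_mat(2,3))
      ultimately show ?thesis by (simp only:)
    qed
    have "(?W * mat (n p) (n 0) (?S p)) $$ (a,b)
        = (\<Sum>k<n p. \<Sum>q\<in>{1..p}. ?W $$ (a,k) * (P q (p - q) * D q * P 0 (q - 1)) $$ (k,b))"
      using ab Wc by (subst index_mult_mat_sum) (auto simp: sum_distrib_left)
    also have "\<dots> = (\<Sum>q\<in>{1..p}. (P q (Suc p - q) * D q * P 0 (q - 1)) $$ (a,b))"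
      by (subst sum.swap) (intro sum.cong refl step)
    finally have "(?W * mat (n p) (n 0) (?S p)) $$ (a,b)
        = (\<Sum>q\<in>{1..p}. (P q (Suc p - q) * D q * P 0 (q - 1)) $$ (a,b))" .
    moreover have "P (Suc p) 0 * D (Suc p) = D (Suc p)"
      unfolding P_def using Dc by simp
    ultimately show "(D (Suc p) * P 0 p + ?W * mat (n p) (n 0) (?S p)) $$ (a,b)
        = mat (n (Suc p)) (n 0) (?S (Suc p)) $$ (a,b)"
      using ab Wc by (simp del: index_mult_mat(1))
  qed (use Wc in auto)
  ultimately show ?case by (simp add: P_def)
qed

subsection \<open>The flow of the end-to-end matrix\<close>

text \<open>The velocity of a layer has the form
  \<open>a \<cdot>\<^sub>m A - b \<cdot>\<^sub>m B\<close>; this rule and the next two carry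
  products and transposes through it.\<close>

lemma lincomb_mult_mat:
  fixes A B C :: "'a :: comm_ring_1 mat"
  assumes "A \<in> carrier_mat r c" "B \<in> carrier_mat r c" "C \<in> carrier_mat c e"
  shows "(a \<cdot>\<^sub>m A - b \<cdot>\<^sub>m B) * C = a \<cdot>\<^sub>m (A * C) - b \<cdot>\<^sub>m (B * C)"
  using assms by (simp add: minus_mult_distrib_mat[of _ r c _ _ e] mult_smult_assoc_mat[of _ r c _ e])

lemma mult_lincomb_mat:
  fixes A B C :: "'a :: comm_ring_1 mat"
  assumes "A \<in> carrier_mat r c" "B \<in> carrier_mat r c" "C \<in> carrier_mat e r"
  shows "C * (a \<cdot>\<^sub>m A - b \<cdot>\<^sub>m B) = a \<cdot>\<^sub>m (C * A) - b \<cdot>\<^sub>m (C * B)"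
  using assms by (simp add: mult_minus_distrib_mat[of _ e r _ c] mult_smult_distrib[of _ e r _ c])

lemma transpose_lincomb_mat:
  assumes "A \<in> carrier_mat r c" "B \<in> carrier_mat r c"
  shows "(a \<cdot>\<^sub>m A - b \<cdot>\<^sub>m B :: 'a :: comm_ring_1 mat)\<^sup>T = a \<cdot>\<^sub>m A\<^sup>T - b \<cdot>\<^sub>m B\<^sup>T"
  using assms by (intro eq_matI) auto

text \<open>For consecutive weights \<open>X\<close> and \<open>Y\<close> with loss gradients
  \<open>A\<close> and \<open>B\<close>. By \<open>exchange\<close> and its transpose the gradient
  terms cancel in pairs, and each Gram matrix keeps the decay coefficient \<open>a\<close>
  twice.\<close>

lemma gram_difference_derivative:
  fixes X Y A B :: "'a :: comm_ring_1 mat" and a b :: 'a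
  assumes X: "X \<in> carrier_mat r c" and A: "A \<in> carrier_mat r c"
    and Y: "Y \<in> carrier_mat c e" and B: "B \<in> carrier_mat c e"
    and exchange: "X\<^sup>T * A = B * Y\<^sup>T"
  defines "X' \<equiv> a \<cdot>\<^sub>m X - b \<cdot>\<^sub>m A" and "Y' \<equiv> a \<cdot>\<^sub>m Y - b \<cdot>\<^sub>m B"
  shows "(X'\<^sup>T * X + X\<^sup>T * X') - (Y' * Y\<^sup>T + Y * Y'\<^sup>T) = (2 * a) \<cdot>\<^sub>m (X\<^sup>T * X - Y * Y\<^sup>T)"
proof -
  have "A\<^sup>T * X = (X\<^sup>T * A)\<^sup>T" using X A by (simp add: transpose_mult_dim)
  also have "\<dots> = Y * B\<^sup>T" unfolding exchange using Y B by (simp add: transpose_mult_dim)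
  finally have exchange': "A\<^sup>T * X = Y * B\<^sup>T" .
  have "X'\<^sup>T * X = a \<cdot>\<^sub>m (X\<^sup>T * X) - b \<cdot>\<^sub>m (Y * B\<^sup>T)"
    unfolding X'_def transpose_lincomb_mat[OF X A] exchange'[symmetric]
    by (rule lincomb_mult_mat) (use X A in auto)
  moreover have "X\<^sup>T * X' = a \<cdot>\<^sub>m (X\<^sup>T * X) - b \<cdot>\<^sub>m (B * Y\<^sup>T)"
    unfolding X'_def exchange[symmetric] by (rule mult_lincomb_mat) (use X A in auto)
  moreover have "Y' * Y\<^sup>T = a \<cdot>\<^sub>m (Y * Y\<^sup>T) - b \<cdot>\<^sub>m (B * Y\<^sup>T)"
    unfolding Y'_def by (rule lincomb_mult_mat) (use Y B in auto)
  moreover have "Y * Y'\<^sup>T = a \<cdot>\<^sub>m (Y * Y\<^sup>T) - b \<cdot>\<^sub>m (Y * B\<^sup>T)"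
    unfolding Y'_def transpose_lincomb_mat[OF Y B] by (rule mult_lincomb_mat) (use Y B in auto)
  ultimately show ?thesis
    using X Y B by (intro eq_matI) (auto simp: algebra_simps simp del: index_mult_mat(1))
qed

text \<open>\<open>T\<close> is an arbitrary interval with left end \<open>t0\<close>, so
  trajectories that exist only for a finite time are covered, with one-sided derivatives at the
  ends.\<close>

theorem theorem1:
  fixes N m d k :: nat and n :: "nat \<Rightarrow> nat" and \<eta> lam t0 :: real and T :: "real set"
    and l :: "real vec \<Rightarrow> real vec \<Rightarrow> real" and x y :: "nat \<Rightarrow> real vec"
    and L1 :: "real mat \<Rightarrow> real"
    and W :: "nat \<Rightarrow> real \<Rightarrow> real mat" and We :: "real \<Rightarrow> real mat"
  assumes N: "N \<ge> 1"
    and n_pos: "\<forall>j\<le>N. n j > 0"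
    and n_first: "n 0 = d" and n_last: "n N = k"
    and eta: "\<eta> > 0" and lam_nonneg: "lam \<ge> 0"
    and m: "m \<ge> 1"
    and data: "\<forall>i\<in>{1..m}. x i \<in> carrier_vec d \<and> y i \<in> carrier_vec k"
    and l_nonneg: "\<forall>u\<in>carrier_vec k. \<forall>v\<in>carrier_vec k. l u v \<ge> 0"
    and L1_def: "L1 = linear_loss l m x y"
    and L1_diff: "\<forall>A\<in>carrier_mat k d. mat_differentiable_at L1 A"
    and T_interval: "is_interval T" and t0_in: "t0 \<in> T" and T_after: "T \<subseteq> {t0..}"
    and W_dim: "\<forall>j\<in>{1..N}. \<forall>t\<in>T. W j t \<in> carrier_mat (n j) (n (j - 1))"
    and flow: "\<forall>j\<in>{1..N}. \<forall>t\<in>T. has_mat_derivative_within (W j)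
        (- (\<eta> * lam) \<cdot>\<^sub>m W j t - \<eta> \<cdot>\<^sub>m deep_loss_grad L1 N j (\<lambda>i. W i t)) t T"
    and balanced: "\<forall>j\<in>{1..<N}. (W (j + 1) t0)\<^sup>T * W (j + 1) t0 = W j t0 * (W j t0)\<^sup>T"
    and We_def: "\<forall>t. We t = end_to_end (\<lambda>i. W i t) N"
  shows "\<forall>t\<in>T. has_mat_derivative_within We
      (- (\<eta> * lam * real N) \<cdot>\<^sub>m We t
        - \<eta> \<cdot>\<^sub>m (\<Oplus>\<^bsub>module_mat TYPE(real) k d\<^esub> j\<in>{1..N}.
             psd_power (We t * (We t)\<^sup>T) ((real j - 1) / real N)
             * mat_grad L1 (We t)
             * psd_power ((We t)\<^sup>T * We t) ((real N - real j) / real N))) t T"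
proof -
  \<comment> \<open>\<open>Gr j t\<close> is the gradient of layer \<open>j\<close> in chain-rule
    form and \<open>V j t\<close> the velocity built from it; \<open>flow'\<close> ties both to the
    given dynamics.\<close>
  define P where "P t = layer_prod n (\<lambda>i. W i t)" for t
  define Gr where "Gr j t = (P t j (N - j))\<^sup>T * mat_grad L1 (We t) * (P t 0 (j - 1))\<^sup>T" for j t
  define V where "V j t = - (\<eta> * lam) \<cdot>\<^sub>m W j t - \<eta> \<cdot>\<^sub>m Gr j t" for j t
  have net: "layered_weights N n (\<lambda>i. W i t)" if "t \<in> T" for t
    by standard (use W_dim that in auto)
  have We: "We t = P t 0 N" if "t \<in> T" for t
    unfolding P_def We_def[rule_format]
    by (rule end_to_end_eq_layer_prod) (use W_dim that N in force)
  have Pc: "P t i p \<in> carrier_mat (n (i + p)) (n i)" if "t \<in> T" "i + p \<le> N" for t i p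
    unfolding P_def using layered_weights.layer_prod_carrier[OF net] that by blast
  have Wec: "We t \<in> carrier_mat k d" if "t \<in> T" for t
    using Pc[OF that, of 0 N] We[OF that] n_first n_last by simp
  have Gc: "mat_grad L1 (We t) \<in> carrier_mat (n N) (n 0)" if "t \<in> T" for t
    using Wec[OF that] n_first n_last unfolding mat_grad_def by auto
  have Grc: "Gr j t \<in> carrier_mat (n j) (n (j - 1))" if "t \<in> T" "1 \<le> j" "j \<le> N" for j t
  proof -
    have "P t j (N - j) \<in> carrier_mat (n N) (n j)" using Pc[of t j "N - j"] that by simp
    moreover have "P t 0 (j - 1) \<in> carrier_mat (n (j - 1)) (n 0)"
      using Pc[OF that(1), of 0 "j - 1"] le_trans[OF diff_le_self that(3), of 1] by simp
    ultimately show ?thesis using Gc[OF that(1)] unfolding Gr_def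
      by (auto intro!: mult_carrier_mat[of _ _ "n 0"] mult_carrier_mat[of _ _ "n N"])
  qed
  have Vc: "V j t \<in> carrier_mat (n j) (n (j - 1))" if "t \<in> T" "1 \<le> j" "j \<le> N" for j t
    unfolding V_def using Grc[OF that] by auto
  have flow': "has_mat_derivative_within (W j) (V j t) t T" if t: "t \<in> T" and j: "1 \<le> j" "j \<le> N" for j t
  proof -
    have grad: "deep_loss_grad L1 N j (\<lambda>i. W i t) = Gr j t"
      unfolding Gr_def We[OF t] unfolding P_def
      by (rule layered_weights.deep_loss_grad_eq[OF net[OF t] j])
         (use L1_diff Wec[OF t] We[OF t] P_def in simp)
    have "j \<in> {1..N}" using j by simp
    then show ?thesis using flow t unfolding V_def grad[symmetric] by blast
  qed
  have balanced_t: "(W (j + 1) t)\<^sup>T * W (j + 1) t = W j t * (W j t)\<^sup>T"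
    if t: "t \<in> T" and j: "1 \<le> j" "j < N" for j t
  proof -
    define D where "D s = (W (j + 1) s)\<^sup>T * W (j + 1) s - W j s * (W j s)\<^sup>T" for s
    have c: "W (j + 1) s \<in> carrier_mat (n (j + 1)) (n j)" "W j s \<in> carrier_mat (n j) (n (j - 1))"
      "Gr (j + 1) s \<in> carrier_mat (n (j + 1)) (n j)" "Gr j s \<in> carrier_mat (n j) (n (j - 1))"
      "V (j + 1) s \<in> carrier_mat (n (j + 1)) (n j)" "V j s \<in> carrier_mat (n j) (n (j - 1))"
      if s: "s \<in> T" for s
      using W_dim[rule_format, of "j + 1" s] W_dim[rule_format, of j s] Grc[OF s, of "j + 1"] Grc[OF s, of j]
        Vc[OF s, of "j + 1"] Vc[OF s, of j] s j by simp_all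
    have Dc: "D s \<in> carrier_mat (n j) (n j)" if "s \<in> T" for s
      using c[OF that] unfolding D_def by (intro minus_carrier_mat mult_carrier_mat[of _ _ "n (j - 1)"]) auto
    have deriv: "has_mat_derivative_within D ((2 * - (\<eta> * lam)) \<cdot>\<^sub>m D s) s T" if s: "s \<in> T" for s
    proof -
      have "(W (j + 1) s)\<^sup>T * Gr (j + 1) s = Gr j s * (W j s)\<^sup>T"
        using layered_weights.layer_grad_exchange[OF net[OF s] j Gc[OF s]]
        unfolding Gr_def P_def by simp
      note gram = gram_difference_derivative[OF c(1,3,2,4)[OF s] this,
          of "- (\<eta> * lam)" \<eta>, folded V_def D_def]
      have "has_mat_derivative_within D (((V (j + 1) s)\<^sup>T * W (j + 1) s + (W (j + 1) s)\<^sup>T * V (j + 1) s)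
          - (V j s * (W j s)\<^sup>T + W j s * (V j s)\<^sup>T)) s T"
        unfolding D_def
        by (intro has_mat_derivative_within_diff has_mat_derivative_within_mult
            has_mat_derivative_within_transpose flow') (use s j c[OF s] in auto)
      then show ?thesis unfolding gram .
    qed
    \<comment> \<open>The equation for \<open>D\<close> has a scalar coefficient, so it decouples
      into one linear equation per entry.\<close>
    have "D t $$ (a,b) = 0" if ab: "a < n j" "b < n j" for a b
    proof (rule linear_ode_zero[where y = "\<lambda>s. D s $$ (a,b)", OF T_interval t0_in])
      show "D t0 $$ (a,b) = 0"
        unfolding D_def using balanced j c(2)[OF t0_in] ab by (simp del: index_mult_mat(1))
      show "((\<lambda>s. D s $$ (a,b)) has_real_derivative 2 * - (\<eta> * lam) * D s $$ (a,b)) (at s within T)"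
        if "s \<in> T" for s
        using deriv[OF that] Dc[OF that] ab unfolding has_mat_derivative_within_def by auto
    qed (rule t)
    then show ?thesis
      using c[OF t] unfolding D_def by (intro eq_matI) (auto simp del: index_mult_mat(1))
  qed
  show ?thesis
  proof
    fix t assume t: "t \<in> T"
    interpret layered_weights N n "\<lambda>i. W i t" by (rule net[OF t])
    define F where "F j = psd_power (We t * (We t)\<^sup>T) ((real j - 1) / real N) * mat_grad L1 (We t)
        * psd_power ((We t)\<^sup>T * We t) ((real N - real j) / real N)" for j
    \<comment> \<open>The left exponent \<open>(N - q) / N\<close> of layer \<open>q\<close> is
      \<open>(j - 1) / N\<close> for \<open>j = N + 1 - q\<close>: the summands come in reverse
      order, which \<open>sum.atLeastAtMost_rev\<close> undoes below.\<close>
    have F: "P t q (N - q) * Gr q t * P t 0 (q - 1) = F (N + 1 - q)" if q: "1 \<le> q" "q \<le> N" for q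
      using layer_grad_preconditioned[OF balanced_t[OF t] q Gc[OF t]] q
      unfolding F_def Gr_def We[OF t] P_def by (simp add: of_nat_diff)
    \<comment> \<open>\<open>psd_power\<close> is a definite description, so the format of
      \<open>F j\<close> is read off from the product of layers that it equals.\<close>
    have Fc: "F j \<in> carrier_mat k d" if j: "j \<in> {1..N}" for j
    proof -
      have "F j = P t (N + 1 - j) (j - 1) * Gr (N + 1 - j) t * P t 0 (N - j)"
      proof -
        have "1 \<le> N + 1 - j" "N + 1 - j \<le> N" "N - (N + 1 - j) = j - 1" "N + 1 - j - 1 = N - j"
          "N + 1 - (N + 1 - j) = j"
          using j by auto
        with F[OF this(1,2)] show ?thesis by simp
      qed
      then show ?thesis
        using Pc[OF t, of "N + 1 - j" "j - 1"] Grc[OF t, of "N + 1 - j"] Pc[OF t, of 0 "N - j"] j n_first n_last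
        by (auto intro!: mult_carrier_mat)
    qed
    \<comment> \<open>The decay part restores the whole product for every \<open>q\<close>, hence
      the factor \<open>N\<close> after summation.\<close>
    have layer: "P t q (N - q) * V q t * P t 0 (q - 1) = - (\<eta> * lam) \<cdot>\<^sub>m We t - \<eta> \<cdot>\<^sub>m F (N + 1 - q)"
      if q: "1 \<le> q" "q \<le> N" for q
    proof -
      have c: "P t q (N - q) \<in> carrier_mat (n N) (n q)" "P t 0 (q - 1) \<in> carrier_mat (n (q - 1)) (n 0)"
        using Pc[OF t, of q "N - q"] Pc[OF t, of 0 "q - 1"] q by auto
      show ?thesis
        unfolding V_def F[OF q, symmetric] We[OF t]
        using layer_prod_factor[OF q, folded P_def] weight_carrier[OF q] Grc[OF t q] c
        by (simp add: mult_lincomb_mat[of _ "n q" "n (q - 1)" _ _ "n N"]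
            lincomb_mult_mat[of _ "n N" "n (q - 1)" _ _ "n 0"] del: assoc_mult_mat)
    qed
    let ?D = "mat (n N) (n 0) (\<lambda>ab. \<Sum>q\<in>{1..N}. (P t q (N - q) * V q t * P t 0 (q - 1)) $$ ab)"
    have "has_mat_derivative_within (\<lambda>s. P s 0 N) ?D t T"
      unfolding P_def
      by (rule has_mat_derivative_within_layer_prod) (use flow' Vc t in auto)
    then have "has_mat_derivative_within We ?D t T"
      by (rule has_mat_derivative_within_cong) (use We t in auto)
    also have "?D = - (\<eta> * lam * real N) \<cdot>\<^sub>m We t
        - \<eta> \<cdot>\<^sub>m (\<Oplus>\<^bsub>module_mat TYPE(real) k d\<^esub> j\<in>{1..N}. F j)"
      (is "_ = ?R")
    proof (rule eq_matI)
      have R: "(\<Oplus>\<^bsub>module_mat TYPE(real) k d\<^esub> j\<in>{1..N}. F j) = mat k d (\<lambda>ab. \<Sum>j\<in>{1..N}. F j $$ ab)"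
        using Fc by (intro index_finsum_mat) auto
      then show "dim_row ?D = dim_row ?R" "dim_col ?D = dim_col ?R" using n_first n_last by auto
      fix a b assume "a < dim_row ?R" "b < dim_col ?R"
      then have ab: "a < k" "b < d" using R by auto
      have "?D $$ (a,b) = (\<Sum>q\<in>{1..N}. (P t q (N - q) * V q t * P t 0 (q - 1)) $$ (a,b))"
        using ab n_first n_last by simp
      also have "\<dots> = (\<Sum>q\<in>{1..N}. - (\<eta> * lam) * We t $$ (a,b) - \<eta> * F (N + 1 - q) $$ (a,b))"
      proof (rule sum.cong[OF refl])
        fix q assume q: "q \<in> {1..N}"
        then have "N + 1 - q \<in> {1..N}" by auto
        from Fc[OF this] show "(P t q (N - q) * V q t * P t 0 (q - 1)) $$ (a,b)
            = - (\<eta> * lam) * We t $$ (a,b) - \<eta> * F (N + 1 - q) $$ (a,b)"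
          using q ab Wec[OF t] by (subst layer) auto
      qed
      also have "\<dots> = - (\<eta> * lam * real N) * We t $$ (a,b) - \<eta> * (\<Sum>q\<in>{1..N}. F (N + 1 - q) $$ (a,b))"
        by (simp add: sum_subtractf sum_distrib_left)
      also have "(\<Sum>q\<in>{1..N}. F (N + 1 - q) $$ (a,b)) = (\<Sum>j\<in>{1..N}. F j $$ (a,b))"
        by (rule sum.atLeastAtMost_rev[symmetric])
      finally show "?D $$ (a,b) = ?R $$ (a,b)"
        unfolding R using ab Wec[OF t] by simp
    qed
    finally show "has_mat_derivative_within We (- (\<eta> * lam * real N) \<cdot>\<^sub>m We t
        - \<eta> \<cdot>\<^sub>m (\<Oplus>\<^bsub>module_mat TYPE(real) k d\<^esub> j\<in>{1..N}.
             psd_power (We t * (We t)\<^sup>T) ((real j - 1) / real N)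
             * mat_grad L1 (We t)
             * psd_power ((We t)\<^sup>T * We t) ((real N - real j) / real N))) t T"
      unfolding F_def .
  qed
qed

end
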